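(* Every finite simple graph with at most $5$ vertices is good.
   Context: $\mu$ is Lebesgue measure on $[0,1]$. $\mathcal{H}$ is the space of bounded measurable real functions on $[0,1]^2$. A bounded measurable nonnegative symmetric function $g$ on $[0,1]^2$ is called doubly nonnegative if there is $h\in\mathcal{H}$ (possibly taking negative values) with $g(x,y)=\int_{[0,1]}h(x,z)h(y,z)\,d\mu(z)$ for (almost) all $x,y$. For a finite simple graph $G$ with vertices $v_1,\dots,v_n$ and edge set $E(G)$, $t(G,g)=\int_{[0,1]^n}\prod_{\{v_i,v_j\}\in E(G)}g(x_i,x_j)\,d\mu^n$. A finite simple graph $G$ is called good if $t(G,g)\ge\left(\int_{[0,1]^2}g\,d\mu^2\right)^{|E(G)|}$ for every doubly nonnegative function $g$. *)

theory Defs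
  imports "HOL-Analysis.Analysis"
begin

abbreviation unit_measure :: "real measure" where
  "unit_measure \<equiv> lebesgue_on {0..1}"

text \<open>Product measures are completed, so that ``measurable'' on $[0,1]^2$ and on $[0,1]^n$ means
  Lebesgue measurable, not just measurable for the product sigma-algebra.\<close>

abbreviation unit_square_measure :: "(real \<times> real) measure" where
  "unit_square_measure \<equiv> completion (unit_measure \<Otimes>\<^sub>M unit_measure)"

abbreviation unit_cube_measure :: "'v set \<Rightarrow> ('v \<Rightarrow> real) measure" where
  "unit_cube_measure V \<equiv> completion (Pi\<^sub>M V (\<lambda>_. unit_measure))"

text \<open>Functions on $[0,1]^2$ are total functions on pairs of reals; only their values on the square
  are ever used.\<close>

definition bounded_measurable :: "(real \<times> real \<Rightarrow> real) set" where
  "bounded_measurable =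
     {h. h \<in> borel_measurable unit_square_measure \<and> bounded (h ` ({0..1} \<times> {0..1}))}"

definition doubly_nonnegative :: "(real \<times> real \<Rightarrow> real) \<Rightarrow> bool" where
  "doubly_nonnegative g \<longleftrightarrow>
     g \<in> bounded_measurable \<and>
     (\<forall>x\<in>{0..1}. \<forall>y\<in>{0..1}. 0 \<le> g (x, y)) \<and>
     (\<forall>x\<in>{0..1}. \<forall>y\<in>{0..1}. g (x, y) = g (y, x)) \<and>
     (\<exists>h\<in>bounded_measurable.
        AE (x, y) in unit_square_measure. g (x, y) = (LINT z|unit_measure. h (x, z) * h (y, z)))"

definition finite_simple_graph :: "'v set \<Rightarrow> 'v set set \<Rightarrow> bool" where
  "finite_simple_graph V E \<longleftrightarrow> finite V \<and> (\<forall>e\<in>E. e \<subseteq> V \<and> card e = 2)"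

text \<open>The factor $g(x_u,x_v)$ belonging to an unordered edge $e=\{u,v\}$. The description is
  unique because $g$ is symmetric on the square, see \<open>edge_factor_eq\<close>.\<close>

definition edge_factor :: "(real \<times> real \<Rightarrow> real) \<Rightarrow> ('v \<Rightarrow> real) \<Rightarrow> 'v set \<Rightarrow> real" where
  "edge_factor g x e = (THE r. \<exists>u v. e = {u, v} \<and> u \<noteq> v \<and> r = g (x u, x v))"

lemma edge_factor_eq:
  assumes "\<forall>x\<in>{0..1}. \<forall>y\<in>{0..1}. g (x, y) = g (y, x)"
    and "u \<noteq> v" "x u \<in> {0..1}" "x v \<in> {0..1}"
  shows "edge_factor g x {u, v} = g (x u, x v)"
proof -
  have "g (x v, x u) = g (x u, x v)"
    using assms by blast
  then show ?thesis
    unfolding edge_factor_def using assms(2)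
    by (intro the_equality) (auto simp: doubleton_eq_iff)
qed

definition hom_density :: "'v set \<Rightarrow> 'v set set \<Rightarrow> (real \<times> real \<Rightarrow> real) \<Rightarrow> real" where
  "hom_density V E g = (LINT x|unit_cube_measure V. (\<Prod>e\<in>E. edge_factor g x e))"

definition good_graph :: "'v set \<Rightarrow> 'v set set \<Rightarrow> bool" where
  "good_graph V E \<longleftrightarrow>
     (\<forall>g. doubly_nonnegative g \<longrightarrow>
        hom_density V E g \<ge> (LINT p|unit_square_measure. g p) ^ card E)"

end

theory Submission imports Defs "HOL-Probability.Infinite_Product_Measure" begin

text \<open>
  Normalise the edge density to 1 and write \<open>T\<close> for the integral operator of \<open>g\<close>, \<open>deg = T 1\<close> and
  \<open>Q f = \<langle>f, T f\<rangle>\<close>. Positive definiteness enters through the Cauchy--Schwarz inequality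
  \<open>Q f \<ge> \<langle>f, deg\<rangle>\<^sup>2\<close>: if a graph has a reflection and the only edge between its two halves joins
  mirror vertices, then this edge may be replaced by a pendant edge in each half.

  A cone over a good graph \<open>H\<close> with \<open>n\<close> vertices and \<open>e\<close> edges is good: conditionally on the apex
  \<open>z\<close>, its density is \<open>deg z ^ n\<close> times the density of \<open>H\<close> for the measure \<open>g(z, \<sqdot>) / deg z\<close>, which is
  at least \<open>deg z ^ n * (T deg z / deg z) ^ (2 * e)\<close>, and by Bernoulli's inequality the integral of this
  bound is controlled by \<open>\<langle>deg powr s, T deg\<rangle> \<ge> 1\<close> with \<open>s = (n - 1) / (2 * e)\<close>. Disjoint
  unions of good graphs are good. Twelve connected graphs on at most five vertices have no dominating
  vertex, and each of them is treated by reflections; for the house one also needs the Schur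
  product of \<open>g\<close> with another positive definite kernel.
\<close>

section \<open>Bounded functions and convexity inequalities\<close>

text \<open>Both sides of the inequality scale alike in the kernel, so with edge density 1 every
  bound has the form \<open>1 \<le> ...\<close>, and the power-mean steps become tangent lines at 1.
  In the cone step, the edge density for the measure \<open>g z x / deg z\<close> is a triangle
  rooted at \<open>z\<close>, divided by \<open>(deg z)\<^sup>2\<close>. The base of this triangle
  joins mirror vertices; replacing it by pendant edges bounds the edge density below by the square
  of \<open>T deg z / deg z\<close>, which is the origin of the exponent \<open>2 * e\<close>. Since
  the hypothesis on the smaller graph is used for this new measure, goodness is proved for kernels
  over all probability measures on the reals. The obstacle in the house is that its reflection
  crosses two edges. One of them is replaced by means of a difference of kernels that is positive
  definite; the Schur property lets this comparison survive multiplication by the other edge, which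
  is then replaced in the ordinary way.\<close>

definition bounded_fun :: "('a \<Rightarrow> real) \<Rightarrow> bool" where
  "bounded_fun f \<longleftrightarrow> (\<exists>B. \<forall>x. \<bar>f x\<bar> \<le> B)"

lemma bounded_funI: "(\<And>x. \<bar>f x\<bar> \<le> B) \<Longrightarrow> bounded_fun f"
  unfolding bounded_fun_def by blast

text \<open>Boundedness is asked on the whole type and not just on the space of a measure, so that
  every substitution preserves it. The price is paid once, by clipping, when functions on the square
  are brought into this form.\<close>

lemma bounded_fun_comp: "bounded_fun f \<Longrightarrow> bounded_fun (\<lambda>x. f (k x))"
  unfolding bounded_fun_def by blast

named_theorems bounded_fun_intros

lemma bounded_fun_const [bounded_fun_intros]: "bounded_fun (\<lambda>x. c)"
  by (rule bounded_funI) (rule order_refl)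

lemma bounded_fun_add [bounded_fun_intros]:
  assumes "bounded_fun f" "bounded_fun k"
  shows "bounded_fun (\<lambda>x. f x + k x)"
proof -
  from assms obtain B C where "\<And>x. \<bar>f x\<bar> \<le> B" "\<And>x. \<bar>k x\<bar> \<le> C"
    unfolding bounded_fun_def by blast
  then have "\<bar>f x + k x\<bar> \<le> B + C" for x
    by (meson abs_triangle_ineq add_mono order_trans)
  then show ?thesis by (rule bounded_funI)
qed

lemma bounded_fun_mult [bounded_fun_intros]:
  assumes "bounded_fun f" "bounded_fun k"
  shows "bounded_fun (\<lambda>x. f x * k x)"
proof -
  from assms obtain B C where "\<And>x. \<bar>f x\<bar> \<le> B" "\<And>x. \<bar>k x\<bar> \<le> C"
    unfolding bounded_fun_def by blast
  then have "\<bar>f x * k x\<bar> \<le> B * C" for x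
    unfolding abs_mult by (intro mult_mono) (auto intro: order_trans[OF abs_ge_zero])
  then show ?thesis by (rule bounded_funI)
qed

lemma bounded_fun_diff [bounded_fun_intros]:
  assumes "bounded_fun f" "bounded_fun k"
  shows "bounded_fun (\<lambda>x. f x - k x)"
  using bounded_fun_add[OF assms(1) bounded_fun_mult[OF bounded_fun_const[of "-1"] assms(2)]]
  by simp

lemma bounded_fun_power [bounded_fun_intros]:
  "bounded_fun f \<Longrightarrow> bounded_fun (\<lambda>x. f x ^ n)"
  by (induction n) (auto intro!: bounded_fun_intros)

lemma bounded_fun_prod [bounded_fun_intros]:
  "(\<And>i. i \<in> I \<Longrightarrow> bounded_fun (f i)) \<Longrightarrow> bounded_fun (\<lambda>x. \<Prod>i\<in>I. f i x)"
  by (induction I rule: infinite_finite_induct) (auto intro!: bounded_fun_intros)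

lemma bounded_fun_le:
  assumes "bounded_fun f" "\<And>x. \<bar>k x\<bar> \<le> f x"
  shows "bounded_fun k"
proof -
  from assms(1) obtain B where "\<And>x. \<bar>f x\<bar> \<le> B"
    unfolding bounded_fun_def by blast
  then have "\<bar>k x\<bar> \<le> B" for x
    using assms(2)[of x] by (meson abs_ge_self order_trans)
  then show ?thesis by (rule bounded_funI)
qed

lemma (in prob_space) bounded_fun_integral [bounded_fun_intros]:
  assumes "bounded_fun (\<lambda>p. F (fst p) (snd p))"
  shows "bounded_fun (\<lambda>x. \<integral>y. F x y \<partial>M)"
proof -
  obtain B where B: "\<bar>F x y\<bar> \<le> B" for x y
    using assms unfolding bounded_fun_def by auto
  have "\<bar>\<integral>y. F x y \<partial>M\<bar> \<le> B" for x
  proof -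
    have "\<bar>\<integral>y. F x y \<partial>M\<bar> \<le> (\<integral>y. \<bar>F x y\<bar> \<partial>M)"
      by (rule integral_abs_bound)
    also have "\<dots> \<le> (\<integral>y. B \<partial>M)"
      using B order_trans[OF abs_ge_zero B] by (intro integral_mono') auto
    finally show ?thesis by (simp add: prob_space)
  qed
  then show ?thesis by (rule bounded_funI)
qed

lemma (in finite_measure) integrable_bounded_fun:
  assumes "f \<in> borel_measurable M" "bounded_fun f"
  shows "integrable M f"
proof -
  from assms(2) obtain B where "\<And>x. \<bar>f x\<bar> \<le> B"
    unfolding bounded_fun_def by blast
  then show ?thesis
    using assms(1) by (intro integrable_const_bound[of _ B]) auto
qed

lemma (in prob_space) integral_swap:
  fixes f :: "'a \<Rightarrow> 'a \<Rightarrow> real"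
  assumes [measurable]: "(\<lambda>(x, y). f x y) \<in> borel_measurable (M \<Otimes>\<^sub>M M)"
    and "bounded_fun (\<lambda>(x, y). f x y)"
  shows "(\<integral>x. \<integral>y. f x y \<partial>M \<partial>M) = (\<integral>y. \<integral>x. f x y \<partial>M \<partial>M)"
proof -
  interpret pair_prob_space M M ..
  show ?thesis
    using assms(2) by (intro Fubini_integral[symmetric] P.integrable_bounded_fun assms(1))
qed

lemma (in prob_space) jensen_square_weighted:
  fixes f w :: "'a \<Rightarrow> real"
  assumes [measurable]: "f \<in> borel_measurable M" "w \<in> borel_measurable M"
    and bd: "bounded_fun f" "bounded_fun w"
    and w: "\<And>x. 0 \<le> w x" "(\<integral>x. w x \<partial>M) = 1"
  shows "(\<integral>x. w x * f x \<partial>M)\<^sup>2 \<le> (\<integral>x. w x * (f x)\<^sup>2 \<partial>M)"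
proof -
  define s where "s = (\<integral>x. w x * f x \<partial>M)"
  note [simp] = integrable_bounded_fun
  have "0 \<le> (\<integral>x. w x * (f x - s)\<^sup>2 \<partial>M)"
    using w by (intro integral_nonneg_AE) auto
  also have "(\<lambda>x. w x * (f x - s)\<^sup>2) = (\<lambda>x. w x * (f x)\<^sup>2 - 2 * s * (w x * f x) + s\<^sup>2 * w x)"
    by (auto simp: fun_eq_iff power2_eq_square algebra_simps)
  also have "(\<integral>x. w x * (f x)\<^sup>2 - 2 * s * (w x * f x) + s\<^sup>2 * w x \<partial>M)
      = (\<integral>x. w x * (f x)\<^sup>2 \<partial>M) - 2 * s * s + s\<^sup>2"
    using bd by (subst Bochner_Integration.integral_add Bochner_Integration.integral_diff;
      (intro integrable_bounded_fun bounded_fun_intros; simp)?)+ (simp add: s_def w)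
  finally show ?thesis by (simp add: s_def power2_eq_square)
qed

text \<open>Integrate the tangent line of the power function at 1. Only means that are at least 1
  have to be treated, thanks to the normalisation.\<close>

lemma (in prob_space) jensen_power:
  fixes f :: "'a \<Rightarrow> real"
  assumes [measurable]: "f \<in> borel_measurable M" and bd: "bounded_fun f" and "\<And>x. 0 \<le> f x"
    and a: "1 \<le> (\<integral>x. f x \<partial>M)"
  shows "1 \<le> (\<integral>x. f x ^ n \<partial>M)"
proof -
  have "1 + real n * (f x - 1) \<le> f x ^ n" for x
    using Bernoulli_inequality[of "f x - 1" n] assms(3)[of x] by simp
  then have "(\<integral>x. 1 + real n * (f x - 1) \<partial>M) \<le> (\<integral>x. f x ^ n \<partial>M)"
    using bd by (intro integral_mono integrable_bounded_fun bounded_fun_intros) auto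
  also have "(\<integral>x. 1 + real n * (f x - 1) \<partial>M) = 1 + real n * ((\<integral>x. f x \<partial>M) - 1)"
    using bd by (simp add: integrable_bounded_fun prob_space)
  finally show ?thesis
    using a by (smt (verit) mult_nonneg_nonneg of_nat_0_le_iff)
qed

text \<open>Young's inequality for \<open>x powr a\<close> and 1 with weights \<open>1/a\<close> and
  \<open>1 - 1/a\<close> bounds \<open>x\<close>; multiplying by \<open>a\<close> gives the tangent
  line at 1.\<close>

lemma bernoulli_powr:
  fixes x a :: real
  assumes "0 \<le> x" "1 \<le> a"
  shows "1 + a * (x - 1) \<le> x powr a"
proof (cases "x = 0")
  case False
  then have x: "0 < x" using assms by simp
  define y where "y = x powr a"
  have "y powr (1/a) * 1 powr (1 - 1/a) \<le> 1/a * y + (1 - 1/a) * 1"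
    using assms False by (intro Youngs_inequality_0) (auto simp: y_def x)
  then have "x \<le> 1/a * y + (1 - 1/a)"
    using assms x by (simp add: y_def powr_powr)
  then have "a * x \<le> a * (1/a * y + (1 - 1/a))"
    using assms by (intro mult_left_mono) auto
  then show ?thesis using assms by (simp add: y_def algebra_simps)
next
  case True
  then show ?thesis using assms by simp
qed

lemma (in prob_space) jensen_powr:
  fixes f :: "'a \<Rightarrow> real"
  assumes [measurable]: "f \<in> borel_measurable M" and bd: "bounded_fun f"
    and bd': "bounded_fun (\<lambda>x. f x powr s)" and "\<And>x. 0 \<le> f x" and s: "1 \<le> s"
    and a: "1 \<le> (\<integral>x. f x \<partial>M)"
  shows "1 \<le> (\<integral>x. f x powr s \<partial>M)"
proof -
  have "(\<integral>x. 1 + s * (f x - 1) \<partial>M) \<le> (\<integral>x. f x powr s \<partial>M)"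
    using bd bd' s assms(4)
    by (intro integral_mono integrable_bounded_fun bounded_fun_intros bernoulli_powr) auto
  also have "(\<integral>x. 1 + s * (f x - 1) \<partial>M) = 1 + s * ((\<integral>x. f x \<partial>M) - 1)"
    using bd by (simp add: integrable_bounded_fun prob_space)
  finally show ?thesis
    using a s by (smt (verit) mult_nonneg_nonneg)
qed

section \<open>Doubly nonnegative kernels\<close>

definition psd_kernel :: "'a measure \<Rightarrow> ('a \<Rightarrow> 'a \<Rightarrow> real) \<Rightarrow> bool" where
  "psd_kernel M R \<longleftrightarrow> (\<forall>\<phi>. \<phi> \<in> borel_measurable M \<longrightarrow> bounded_fun \<phi> \<longrightarrow>
     0 \<le> (\<integral>x. \<integral>y. \<phi> x * R x y * \<phi> y \<partial>M \<partial>M))"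

text \<open>Positive definiteness of \<open>g\<close> is required in the form of the Schur product theorem, since
  this form is what the factorisation through \<open>h\<close> gives and it is stable under a change of measure.\<close>

locale dnn_kernel = prob_space M for M :: "'a measure" +
  fixes g :: "'a \<Rightarrow> 'a \<Rightarrow> real"
  assumes g_measurable: "(\<lambda>(x, y). g x y) \<in> borel_measurable (M \<Otimes>\<^sub>M M)"
    and g_bounded: "bounded_fun (\<lambda>(x, y). g x y)"
    and g_nonneg: "0 \<le> g x y"
    and g_sym: "g x y = g y x"
    and schur: "\<lbrakk>(\<lambda>(x, y). R x y) \<in> borel_measurable (M \<Otimes>\<^sub>M M); bounded_fun (\<lambda>(x, y). R x y);
      psd_kernel M R\<rbrakk> \<Longrightarrow> psd_kernel M (\<lambda>x y. R x y * g x y)"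
begin

lemma g_measurable' [measurable (raw)]:
  assumes "a \<in> N \<rightarrow>\<^sub>M M" "b \<in> N \<rightarrow>\<^sub>M M"
  shows "(\<lambda>p. g (a p) (b p)) \<in> borel_measurable N"
  using measurable_compose[OF measurable_Pair[OF assms] g_measurable] by simp

lemma g_bounded' [bounded_fun_intros]: "bounded_fun (\<lambda>p. g (a p) (b p))"
  using bounded_fun_comp[OF g_bounded, of "\<lambda>p. (a p, b p)"] by simp

definition T :: "('a \<Rightarrow> real) \<Rightarrow> 'a \<Rightarrow> real" where
  "T f x = (\<integral>y. g x y * f y \<partial>M)"

definition Q :: "('a \<Rightarrow> real) \<Rightarrow> real" where
  "Q f = (\<integral>x. f x * T f x \<partial>M)"

definition deg :: "'a \<Rightarrow> real" where
  "deg x = (\<integral>y. g x y \<partial>M)"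

definition edge_density :: real where
  "edge_density = (\<integral>x. deg x \<partial>M)"

lemma T_one: "T (\<lambda>_. 1) = deg"
  by (simp add: T_def deg_def fun_eq_iff)

lemma T_measurable [measurable (raw)]:
  assumes [measurable]: "(\<lambda>(p, y). f p y) \<in> borel_measurable (N \<Otimes>\<^sub>M M)" "k \<in> N \<rightarrow>\<^sub>M M"
  shows "(\<lambda>p. T (f p) (k p)) \<in> borel_measurable N"
  unfolding T_def by measurable

lemma T_bounded [bounded_fun_intros]:
  "bounded_fun (\<lambda>p. f (fst p) (snd p)) \<Longrightarrow> bounded_fun (\<lambda>p. T (f p) (k p))"
  unfolding T_def by (intro bounded_fun_intros)

lemma Q_measurable [measurable (raw)]:
  assumes [measurable]: "(\<lambda>(p, y). f p y) \<in> borel_measurable (N \<Otimes>\<^sub>M M)"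
  shows "(\<lambda>p. Q (f p)) \<in> borel_measurable N"
  unfolding Q_def by measurable

lemma Q_bounded [bounded_fun_intros]:
  assumes "bounded_fun (\<lambda>p. f (fst p) (snd p))"
  shows "bounded_fun (\<lambda>p. Q (f p))"
  unfolding Q_def
  by (intro bounded_fun_intros bounded_fun_comp[OF assms, of "\<lambda>p. (fst (fst p), snd p)", simplified] assms)

lemma deg_measurable [measurable (raw)]:
  "k \<in> N \<rightarrow>\<^sub>M M \<Longrightarrow> (\<lambda>p. deg (k p)) \<in> borel_measurable N"
  unfolding T_one[symmetric] by measurable

lemma deg_bounded [bounded_fun_intros]: "bounded_fun (\<lambda>p. deg (k p))"
  unfolding T_one[symmetric] by (intro bounded_fun_intros)

lemma T_nonneg: "(\<And>y. 0 \<le> f y) \<Longrightarrow> 0 \<le> T f x"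
  unfolding T_def using g_nonneg by (intro integral_nonneg_AE) auto

lemma deg_nonneg: "0 \<le> deg x"
  unfolding T_one[symmetric] by (rule T_nonneg) simp

text \<open>\<open>T (g x) y\<close> is the codegree of \<open>x\<close> and \<open>y\<close>, in
  other words the kernel of the operator \<open>T\<close> applied twice. It is used in this role
  throughout.\<close>

lemma T_row_sym: "T (g x) y = T (g y) x"
  unfolding T_def by (simp add: g_sym[of x] mult.commute)

lemma T_self_adjoint:
  assumes [measurable]: "f \<in> borel_measurable M" "k \<in> borel_measurable M"
    and bd: "bounded_fun f" "bounded_fun k"
  shows "(\<integral>x. f x * T k x \<partial>M) = (\<integral>x. T f x * k x \<partial>M)"
proof -
  have "(\<integral>x. f x * T k x \<partial>M) = (\<integral>x. \<integral>y. f x * (g x y * k y) \<partial>M \<partial>M)"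
    by (simp add: T_def)
  also have "\<dots> = (\<integral>y. \<integral>x. f x * (g x y * k y) \<partial>M \<partial>M)"
    using bd[THEN bounded_fun_comp]
    by (intro integral_swap) (auto simp: case_prod_beta' intro!: bounded_fun_intros)
  also have "\<dots> = (\<integral>y. T f y * k y \<partial>M)"
    unfolding T_def by (intro Bochner_Integration.integral_cong refl)
      (simp add: ac_simps g_sym flip: integral_mult_right_zero)
  finally show ?thesis .
qed

lemma integral_T:
  assumes "f \<in> borel_measurable M" "bounded_fun f"
  shows "(\<integral>x. T f x \<partial>M) = (\<integral>x. deg x * f x \<partial>M)"
  using T_self_adjoint[of "\<lambda>_. 1" f] assms by (simp add: T_one bounded_fun_intros)

text \<open>The form of the constant kernel 1 is the square of an integral, so the Schur property
  applied to this kernel is the positivity of \<open>g\<close> itself.\<close>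

lemma Q_nonneg:
  assumes "f \<in> borel_measurable M" "bounded_fun f"
  shows "0 \<le> Q f"
proof -
  have "psd_kernel M (\<lambda>x y. 1 * g x y)"
    by (rule schur) (auto simp: psd_kernel_def case_prod_beta' intro!: bounded_fun_intros)
  then show ?thesis
    using assms unfolding psd_kernel_def Q_def T_def by (simp add: mult.assoc)
qed

end

locale normalized_dnn_kernel = dnn_kernel +
  assumes edge_density_one: "edge_density = 1"
begin

lemma integral_deg: "(\<integral>x. deg x \<partial>M) = 1"
  using edge_density_one by (simp add: edge_density_def)

text \<open>The Cauchy--Schwarz inequality for the form \<open>Q\<close>, applied to \<open>f\<close> and the constant 1.\<close>

lemma Q_ge:
  assumes [measurable]: "f \<in> borel_measurable M" and bd: "bounded_fun f"
  shows "(\<integral>x. f x * deg x \<partial>M)\<^sup>2 \<le> Q f"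
proof -
  define s where "s = (\<integral>x. f x * deg x \<partial>M)"
  note bd' = bd[THEN bounded_fun_comp]
  have T: "T (\<lambda>x. f x - s) x = T f x - s * deg x" if "x \<in> space M" for x
    unfolding T_def deg_def using that
    by (simp add: right_diff_distrib integrable_bounded_fun bounded_fun_intros bd' mult.commute[of _ s])
  \<comment> \<open>The expansion is \<open>Q f\<close> minus twice \<open>s * s\<close> plus
    \<open>s * s\<close> times \<open>Q\<close> of the constant 1. That last value is the edge
    density 1, so \<open>s\<close> is the optimal shift.\<close>
  have "0 \<le> Q (\<lambda>x. f x - s)"
    by (intro Q_nonneg bounded_fun_intros bd) measurable
  also have "\<dots> = (\<integral>x. f x * T f x - s * (f x * deg x) - s * T f x + s * s * deg x \<partial>M)"
    unfolding Q_def by (intro Bochner_Integration.integral_cong refl) (simp add: T algebra_simps)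
  also have "\<dots> = Q f - s * s - s * (\<integral>x. T f x \<partial>M) + s * s"
    by (simp add: integrable_bounded_fun bounded_fun_intros bd bd' Q_def s_def integral_deg)
  also have "(\<integral>x. T f x \<partial>M) = s"
    using bd by (simp add: integral_T s_def mult.commute)
  finally show ?thesis by (simp add: s_def power2_eq_square)
qed

lemma one_le_integral_deg_power: "1 \<le> (\<integral>x. deg x ^ n \<partial>M)"
  by (intro jensen_power deg_nonneg bounded_fun_intros) (auto simp: integral_deg)

lemma bounded_fun_deg_powr: "0 \<le> s \<Longrightarrow> bounded_fun (\<lambda>p. deg (k p) powr s)"
proof -
  assume s: "0 \<le> s"
  obtain B where "\<bar>deg x\<bar> \<le> B" for x
    using deg_bounded[of "\<lambda>x. x"] unfolding bounded_fun_def by blast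
  then have "\<bar>deg (k p) powr s\<bar> \<le> B powr s" for p
    using s deg_nonneg by (auto intro!: powr_mono2 simp: abs_le_iff)
  then show ?thesis by (rule bounded_funI)
qed

text \<open>By the AM--GM inequality, the asymmetric weights \<open>q x\<close> and \<open>deg y\<close> may be replaced by
  \<open>r x\<close> and \<open>r y\<close> with \<open>r\<close> their geometric mean.\<close>

lemma integral_deg_powr_T_deg_ge:
  assumes s: "0 \<le> s"
  shows "1 \<le> (\<integral>x. deg x powr s * T deg x \<partial>M)"
proof -
  define q where "q x = deg x powr s" for x
  define r where "r x = sqrt (q x * deg x)" for x
  have [measurable]: "q \<in> borel_measurable M" "r \<in> borel_measurable M"
    unfolding q_def r_def by measurable
  have nn: "0 \<le> q x" "0 \<le> deg x" "0 \<le> r x" for x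
    by (auto simp: q_def r_def deg_nonneg)
  have bq: "bounded_fun (\<lambda>p. q (k p))" for k :: "'c \<Rightarrow> 'a"
    unfolding q_def using s by (rule bounded_fun_deg_powr)
  have rq: "2 * (r x * r y) \<le> q x * deg y + q y * deg x" for x y
  proof -
    have "r x * r y = sqrt ((q x * deg y) * (q y * deg x))"
      unfolding r_def by (simp add: real_sqrt_mult ac_simps)
    also have "\<dots> \<le> (q x * deg y + q y * deg x) / 2"
      using nn by (intro arith_geo_mean_sqrt) auto
    finally show ?thesis by simp
  qed
  have br: "bounded_fun (\<lambda>p. r (k p))" for k :: "'c \<Rightarrow> 'a"
  proof (rule bounded_fun_le)
    show "bounded_fun (\<lambda>p. 1 + q (k p) * deg (k p))"
      by (intro bounded_fun_intros bq)
    have "sqrt t \<le> 1 + t" if "0 \<le> t" for t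
      using that arith_geo_mean_sqrt[of 1 t] by simp
    then show "\<bar>r (k p)\<bar> \<le> 1 + q (k p) * deg (k p)" for p
      using nn by (simp add: r_def)
  qed
  \<comment> \<open>\<open>r\<close> is \<open>deg\<close> to the power \<open>(1 + s) / 2\<close>.
    The exponent after multiplication by \<open>deg\<close> is at least 1, so
    \<open>jensen_powr\<close> applies to \<open>deg\<close>, which has mean 1.\<close>
  have pw: "r x * deg x = deg x powr (1 + (1 + s) / 2)" for x
  proof (cases "deg x = 0")
    case False
    then have "deg x > 0" using nn[of x] by linarith
    then show ?thesis
      using powr_add[of "deg x" "1/2" 1]
      by (simp add: r_def q_def powr_half_sqrt[symmetric] powr_mult powr_powr powr_add
        add_divide_distrib)
  qed (auto simp: r_def)
  have "1 \<le> (\<integral>x. r x * deg x \<partial>M)"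
    unfolding pw using s
    by (intro jensen_powr bounded_fun_intros bounded_fun_deg_powr deg_nonneg) (auto simp: integral_deg)
  then have "1 \<le> (\<integral>x. r x * deg x \<partial>M)\<^sup>2"
    by (rule one_le_power)
  also have "\<dots> \<le> Q r"
    by (intro Q_ge br) measurable
  finally have "2 \<le> 2 * Q r" by simp
  also have "2 * Q r = (\<integral>x. 2 * (r x * T r x) \<partial>M)"
    by (simp add: Q_def)
  also have "\<dots> \<le> (\<integral>x. q x * T deg x + T q x * deg x \<partial>M)"
  proof (intro integral_mono integrable_bounded_fun bounded_fun_intros bq br; measurable?)
    fix x assume x: "x \<in> space M"
    have "2 * (r x * T r x) = (\<integral>y. g x y * (2 * (r x * r y)) \<partial>M)"
      unfolding T_def by (simp add: ac_simps flip: integral_mult_right_zero)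
    also have "\<dots> \<le> (\<integral>y. g x y * (q x * deg y + q y * deg x) \<partial>M)"
      using x by (intro integral_mono integrable_bounded_fun bounded_fun_intros bq br
        mult_left_mono rq g_nonneg) measurable
    also have "\<dots> = (\<integral>y. q x * (g x y * deg y) + (g x y * q y) * deg x \<partial>M)"
      by (intro Bochner_Integration.integral_cong refl) (simp add: algebra_simps)
    also have "\<dots> = q x * T deg x + T q x * deg x"
      unfolding T_def using x
      by (subst Bochner_Integration.integral_add;
        (intro integrable_bounded_fun bounded_fun_intros bq; measurable)?) simp
    finally show "2 * (r x * T r x) \<le> q x * T deg x + T q x * deg x" .
  qed
  \<comment> \<open>Self-adjointness of \<open>T\<close> makes the two asymmetric summands
    equal.\<close>
  also have "\<dots> = 2 * (\<integral>x. q x * T deg x \<partial>M)"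
    by (simp add: integrable_bounded_fun bounded_fun_intros bq T_self_adjoint[symmetric])
  finally show ?thesis by (simp add: q_def)
qed

end

section \<open>Inequalities from reflections\<close>

lemma (in prob_space) jensen_square:
  fixes f :: "'a \<Rightarrow> real"
  assumes "f \<in> borel_measurable M" "bounded_fun f"
  shows "(\<integral>x. f x \<partial>M)\<^sup>2 \<le> (\<integral>x. (f x)\<^sup>2 \<partial>M)"
  using jensen_square_weighted[of f "\<lambda>_. 1"] assms by (simp add: bounded_fun_intros prob_space)

lemma (in dnn_kernel) integral_row_T:
  assumes [measurable]: "f \<in> borel_measurable M" "z \<in> space M" and bd: "bounded_fun f"
  shows "(\<integral>y. T (g z) y * f y \<partial>M) = T (T f) z"
  unfolding T_def[of "T f" z] using bd by (intro T_self_adjoint[symmetric] bounded_fun_intros) measurable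

context normalized_dnn_kernel
begin

text \<open>The integrals of this section are graph densities: a factor \<open>deg x\<close> is a
  pendant edge at \<open>x\<close>, \<open>T deg x\<close> a pendant path with two edges,
  \<open>Q (g x)\<close> a triangle at \<open>x\<close>. Here the graph is the path with two edges,
  whose density is the second moment of \<open>deg\<close>.\<close>

lemma integral_T_deg_ge: "1 \<le> (\<integral>x. T deg x \<partial>M)"
proof -
  have "(\<integral>x. T deg x \<partial>M) = (\<integral>x. deg x ^ 2 \<partial>M)"
    by (simp add: integral_T bounded_fun_intros power2_eq_square)
  then show ?thesis
    using one_le_integral_deg_power[of 2] by simp
qed

lemma path4_ge: "1 \<le> (\<integral>x. deg x * T deg x \<partial>M)"
  using integral_deg_powr_T_deg_ge[of 1] by (simp add: deg_nonneg)

lemma fork_ge: "1 \<le> (\<integral>x. (deg x)\<^sup>2 * T deg x \<partial>M)"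
  using integral_deg_powr_T_deg_ge[of 2] by (simp add: deg_nonneg)

lemma path5_ge: "1 \<le> (\<integral>x. (T deg x)\<^sup>2 \<partial>M)"
  by (intro jensen_power bounded_fun_intros integral_T_deg_ge T_nonneg deg_nonneg) measurable

text \<open>This is the reflection step around a fixed vertex \<open>x\<close>: two mirror
  neighbours of \<open>x\<close>, each carrying the weight \<open>f\<close>, are joined by an edge,
  which \<open>Q_ge\<close> replaces by a pendant edge at each of them.\<close>

lemma Q_row_ge:
  assumes [measurable]: "x \<in> space M" "f \<in> borel_measurable M" and bd: "bounded_fun f"
  shows "(T (\<lambda>y. f y * deg y) x)\<^sup>2 \<le> Q (\<lambda>y. g x y * f y)"
  using Q_ge[of "\<lambda>y. g x y * f y"] bd by (simp add: bounded_fun_intros T_def mult.assoc)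

lemma triangle_row_ge: "x \<in> space M \<Longrightarrow> (T deg x)\<^sup>2 \<le> Q (g x)"
  using Q_row_ge[of x "\<lambda>_. 1"] by (simp add: bounded_fun_intros)

lemma codegree_row: "x \<in> space M \<Longrightarrow> (\<integral>y. T (g x) y \<partial>M) = T deg x"
  using integral_row_T[of "\<lambda>_. 1" x] by (simp add: bounded_fun_intros T_one)

lemma cycle4_ge: "1 \<le> (\<integral>x. \<integral>y. (T (g x) y)\<^sup>2 \<partial>M \<partial>M)"
proof -
  note path5_ge
  also have "(\<integral>x. (T deg x)\<^sup>2 \<partial>M) \<le> (\<integral>x. \<integral>y. (T (g x) y)\<^sup>2 \<partial>M \<partial>M)"
  proof (intro integral_mono integrable_bounded_fun bounded_fun_intros; measurable?)
    fix x assume "x \<in> space M"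
    then show "(T deg x)\<^sup>2 \<le> (\<integral>y. (T (g x) y)\<^sup>2 \<partial>M)"
      using jensen_square[of "T (g x)"] by (simp add: bounded_fun_intros codegree_row)
  qed
  finally show ?thesis .
qed

text \<open>The reflection through \<open>x\<close> crosses the opposite edge. With pendant edges in
  its place, two paths with three edges hang from \<open>x\<close>, and Jensen's inequality reduces
  them to a single such path.\<close>

lemma cycle5_ge: "1 \<le> (\<integral>x. Q (T (g x)) \<partial>M)"
proof -
  have "1 \<le> (\<integral>x. T (T deg) x \<partial>M)"
    using path4_ge by (simp add: integral_T bounded_fun_intros)
  then have "1 \<le> (\<integral>x. (T (T deg) x)\<^sup>2 \<partial>M)"
    by (intro jensen_power bounded_fun_intros T_nonneg deg_nonneg) measurable
  also have "\<dots> \<le> (\<integral>x. Q (T (g x)) \<partial>M)"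
  proof (intro integral_mono integrable_bounded_fun bounded_fun_intros; measurable?)
    fix x assume "x \<in> space M"
    then show "(T (T deg) x)\<^sup>2 \<le> Q (T (g x))"
      using Q_ge[of "T (g x)"] by (simp add: bounded_fun_intros integral_row_T)
  qed
  finally show ?thesis .
qed

text \<open>The pendant edge at \<open>x\<close> contributes the probability density
  \<open>deg x\<close>. Jensen's inequality over the opposite vertex \<open>y\<close> gives each
  mirror half its own copy of \<open>y\<close>; the weighted version then leaves one path with three
  edges.\<close>

lemma banner_ge: "1 \<le> (\<integral>x. deg x * (\<integral>y. (T (g x) y)\<^sup>2 \<partial>M) \<partial>M)"
proof -
  have "1 \<le> (\<integral>x. deg x * T deg x \<partial>M)\<^sup>2"
    using path4_ge by (rule one_le_power)
  also have "\<dots> \<le> (\<integral>x. deg x * (T deg x)\<^sup>2 \<partial>M)"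
    by (intro jensen_square_weighted deg_nonneg integral_deg bounded_fun_intros) measurable
  also have "\<dots> \<le> (\<integral>x. deg x * (\<integral>y. (T (g x) y)\<^sup>2 \<partial>M) \<partial>M)"
  proof (intro integral_mono integrable_bounded_fun bounded_fun_intros mult_left_mono deg_nonneg;
      measurable?)
    fix x assume "x \<in> space M"
    then show "(T deg x)\<^sup>2 \<le> (\<integral>y. (T (g x) y)\<^sup>2 \<partial>M)"
      using jensen_square[of "T (g x)"] by (simp add: bounded_fun_intros codegree_row)
  qed
  finally show ?thesis .
qed

lemma tadpole_ge: "1 \<le> (\<integral>x. T deg x * Q (g x) \<partial>M)"
proof -
  have "1 \<le> (\<integral>x. T deg x ^ 3 \<partial>M)"
    by (intro jensen_power bounded_fun_intros T_nonneg deg_nonneg integral_T_deg_ge) measurable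
  also have "\<dots> \<le> (\<integral>x. T deg x * Q (g x) \<partial>M)"
  proof (intro integral_mono integrable_bounded_fun bounded_fun_intros; measurable?)
    fix x assume "x \<in> space M"
    then show "T deg x ^ 3 \<le> T deg x * Q (g x)"
      using mult_left_mono[OF triangle_row_ge T_nonneg[OF deg_nonneg]]
      by (simp add: power3_eq_cube power2_eq_square mult.assoc)
  qed
  finally show ?thesis .
qed

text \<open>The reflection through the vertex \<open>x\<close> of degree two swaps the horns.
  Replacing the edge between their bases leaves in each half a star with three edges, hence the
  third moment of \<open>deg\<close>.\<close>

lemma bull_ge: "1 \<le> (\<integral>x. Q (\<lambda>y. g x y * deg y) \<partial>M)"
proof -
  have "1 \<le> (\<integral>x. deg x ^ 3 \<partial>M)"
    by (rule one_le_integral_deg_power)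
  also have "\<dots> = (\<integral>x. T (\<lambda>y. deg y * deg y) x \<partial>M)"
    by (simp add: integral_T bounded_fun_intros power3_eq_cube mult.assoc)
  finally have "1 \<le> (\<integral>x. (T (\<lambda>y. deg y * deg y) x)\<^sup>2 \<partial>M)"
    by (intro jensen_power bounded_fun_intros T_nonneg mult_nonneg_nonneg deg_nonneg) measurable
  also have "\<dots> \<le> (\<integral>x. Q (\<lambda>y. g x y * deg y) \<partial>M)"
    by (intro integral_mono integrable_bounded_fun bounded_fun_intros Q_row_ge; measurable)
  finally show ?thesis .
qed

text \<open>Given the two vertices of the smaller side, the other three are independent, so the
  density is the third moment of the codegree on the product space; its mean is the density of the
  path with two edges.\<close>

lemma K23_ge: "1 \<le> (\<integral>x. \<integral>y. T (g x) y ^ 3 \<partial>M \<partial>M)"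
proof -
  interpret P: pair_prob_space M M ..
  have "1 \<le> (\<integral>p. T (g (fst p)) (snd p) \<partial>(M \<Otimes>\<^sub>M M))"
  proof -
    have "(\<integral>p. T (g (fst p)) (snd p) \<partial>(M \<Otimes>\<^sub>M M)) = (\<integral>x. T deg x \<partial>M)"
      by (subst P.integral_fst'[symmetric])
        (auto intro!: P.P.integrable_bounded_fun bounded_fun_intros Bochner_Integration.integral_cong
          simp: codegree_row)
    then show ?thesis using integral_T_deg_ge by simp
  qed
  then have "1 \<le> (\<integral>p. T (g (fst p)) (snd p) ^ 3 \<partial>(M \<Otimes>\<^sub>M M))"
    by (intro P.P.jensen_power bounded_fun_intros T_nonneg g_nonneg) measurable
  also have "\<dots> = (\<integral>x. \<integral>y. T (g x) y ^ 3 \<partial>M \<partial>M)"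
    by (subst P.integral_fst'[symmetric]) (auto intro!: P.P.integrable_bounded_fun bounded_fun_intros)
  finally show ?thesis .
qed

text \<open>The edge between the two common neighbours of \<open>x\<close> and \<open>y\<close> is
  replaced by pendant edges. Then \<open>y\<close> is duplicated by Jensen's inequality, and a
  weighted Jensen step with density \<open>deg x\<close> separates the halves, each of which is a
  fork.\<close>

lemma kite_ge: "1 \<le> (\<integral>x. deg x * (\<integral>y. Q (\<lambda>z. g x z * g y z) \<partial>M) \<partial>M)"
proof -
  have "(\<integral>x. deg x * T (\<lambda>y. deg y * deg y) x \<partial>M) = (\<integral>x. (deg x)\<^sup>2 * T deg x \<partial>M)"
    by (subst T_self_adjoint) (auto intro!: bounded_fun_intros simp: power2_eq_square ac_simps)
  then have "1 \<le> (\<integral>x. deg x * T (\<lambda>y. deg y * deg y) x \<partial>M)\<^sup>2"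
    using fork_ge by (intro one_le_power) simp
  also have "\<dots> \<le> (\<integral>x. deg x * (T (\<lambda>y. deg y * deg y) x)\<^sup>2 \<partial>M)"
    by (intro jensen_square_weighted deg_nonneg integral_deg bounded_fun_intros) measurable
  also have "\<dots> \<le> (\<integral>x. deg x * (\<integral>y. Q (\<lambda>z. g x z * g y z) \<partial>M) \<partial>M)"
  proof (intro integral_mono integrable_bounded_fun bounded_fun_intros mult_left_mono deg_nonneg;
      measurable?)
    fix x assume [measurable]: "x \<in> space M"
    have "T (\<lambda>y. deg y * deg y) x = (\<integral>y. T (\<lambda>z. g x z * deg z) y \<partial>M)"
      by (subst integral_T) (auto intro!: bounded_fun_intros simp: T_def ac_simps)
    then have "(T (\<lambda>y. deg y * deg y) x)\<^sup>2 \<le> (\<integral>y. (T (\<lambda>z. g x z * deg z) y)\<^sup>2 \<partial>M)"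
      by (simp only:) (intro jensen_square bounded_fun_intros; measurable)
    also have "\<dots> \<le> (\<integral>y. Q (\<lambda>z. g y z * g x z) \<partial>M)"
      by (intro integral_mono integrable_bounded_fun bounded_fun_intros Q_row_ge; measurable)
    finally show "(T (\<lambda>y. deg y * deg y) x)\<^sup>2 \<le> (\<integral>y. Q (\<lambda>z. g x z * g y z) \<partial>M)"
      by (simp add: mult.commute)
  qed
  finally show ?thesis .
qed

text \<open>A triangle with a pendant edge. It has a dominating vertex and appears here as the half
  left over in \<open>K23_plus_edge_ge\<close>.\<close>

lemma paw_ge: "1 \<le> (\<integral>x. deg x * Q (g x) \<partial>M)"
proof -
  have "1 \<le> (\<integral>x. deg x * T deg x \<partial>M)\<^sup>2"
    using path4_ge by (rule one_le_power)
  also have "\<dots> \<le> (\<integral>x. deg x * (T deg x)\<^sup>2 \<partial>M)"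
    by (intro jensen_square_weighted deg_nonneg integral_deg bounded_fun_intros) measurable
  also have "\<dots> \<le> (\<integral>x. deg x * Q (g x) \<partial>M)"
    by (intro integral_mono integrable_bounded_fun bounded_fun_intros mult_left_mono deg_nonneg
      triangle_row_ge; measurable)
  finally show ?thesis .
qed

text \<open>Jensen's inequality over \<open>w\<close> turns its two edges into pendant edges of the
  mirror vertices. The edge between \<open>x\<close> and \<open>y\<close> is fixed by the
  reflection, so \<open>g x y\<close> serves as a probability density on pairs, and the weighted
  Jensen inequality leaves one paw.\<close>

lemma K23_plus_edge_ge:
  "1 \<le> (\<integral>x. \<integral>y. g x y * (\<integral>w. (T (\<lambda>u. g x u * g y u) w)\<^sup>2 \<partial>M) \<partial>M \<partial>M)"
proof -
  interpret P: pair_prob_space M M ..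
  define S where "S x y = (\<integral>u. g x u * g y u * deg u \<partial>M)" for x y
  have [measurable (raw)]: "(\<lambda>p. S (a p) (b p)) \<in> borel_measurable N"
    if [measurable]: "a \<in> N \<rightarrow>\<^sub>M M" "b \<in> N \<rightarrow>\<^sub>M M" for a b and N :: "'c measure"
    unfolding S_def by measurable
  have bS: "bounded_fun (\<lambda>p. S (a p) (b p))" for a b :: "'c \<Rightarrow> 'a"
    unfolding S_def by (intro bounded_fun_intros)
  have Sx: "(\<integral>y. g x y * S x y \<partial>M) = (\<integral>u. g x u * T (g x) u * deg u \<partial>M)"
    if [measurable]: "x \<in> space M" for x
  proof -
    have "(\<integral>y. g x y * S x y \<partial>M) = (\<integral>y. \<integral>u. g x y * (g x u * g y u * deg u) \<partial>M \<partial>M)"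
      by (simp add: S_def)
    also have "\<dots> = (\<integral>u. \<integral>y. g x y * (g x u * g y u * deg u) \<partial>M \<partial>M)"
      by (intro integral_swap) (auto simp: case_prod_beta' intro!: bounded_fun_intros)
    also have "\<dots> = (\<integral>u. g x u * T (g x) u * deg u \<partial>M)"
      unfolding T_def by (intro Bochner_Integration.integral_cong refl)
        (simp add: ac_simps g_sym flip: integral_mult_right_zero integral_mult_left_zero)
    finally show ?thesis .
  qed
  have "(\<integral>x. \<integral>u. g x u * T (g x) u * deg u \<partial>M \<partial>M) = (\<integral>u. \<integral>x. g x u * T (g x) u * deg u \<partial>M \<partial>M)"
    by (intro integral_swap) (auto simp: case_prod_beta' intro!: bounded_fun_intros)
  also have "\<dots> = (\<integral>u. deg u * Q (g u) \<partial>M)"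
    unfolding Q_def by (intro Bochner_Integration.integral_cong refl)
      (simp add: T_row_sym g_sym mult.commute)
  finally have "1 \<le> (\<integral>x. \<integral>y. g x y * S x y \<partial>M \<partial>M)"
    using paw_ge by (simp add: Sx cong: Bochner_Integration.integral_cong)
  also have "\<dots> = (\<integral>p. g (fst p) (snd p) * S (fst p) (snd p) \<partial>(M \<Otimes>\<^sub>M M))"
    by (subst P.integral_fst'[symmetric])
      (auto intro!: P.P.integrable_bounded_fun bounded_fun_intros bS)
  finally have "1 \<le> (\<integral>p. g (fst p) (snd p) * S (fst p) (snd p) \<partial>(M \<Otimes>\<^sub>M M))\<^sup>2"
    by (rule one_le_power)
  also have "\<dots> \<le> (\<integral>p. g (fst p) (snd p) * (S (fst p) (snd p))\<^sup>2 \<partial>(M \<Otimes>\<^sub>M M))"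
  proof (intro P.P.jensen_square_weighted bounded_fun_intros bS g_nonneg; measurable?)
    show "(\<integral>p. g (fst p) (snd p) \<partial>(M \<Otimes>\<^sub>M M)) = 1"
      using integral_deg unfolding deg_def
      by (subst P.integral_fst'[symmetric]) (auto intro!: P.P.integrable_bounded_fun bounded_fun_intros)
  qed
  also have "\<dots> = (\<integral>x. \<integral>y. g x y * (S x y)\<^sup>2 \<partial>M \<partial>M)"
    by (subst P.integral_fst'[symmetric])
      (auto intro!: P.P.integrable_bounded_fun bounded_fun_intros bS)
  also have "\<dots> \<le> (\<integral>x. \<integral>y. g x y * (\<integral>w. (T (\<lambda>u. g x u * g y u) w)\<^sup>2 \<partial>M) \<partial>M \<partial>M)"
  proof (intro integral_mono integrable_bounded_fun bounded_fun_intros bS mult_left_mono g_nonneg;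
      measurable?)
    fix x y assume [measurable]: "x \<in> space M" "y \<in> space M"
    have "S x y = (\<integral>w. T (\<lambda>u. g x u * g y u) w \<partial>M)"
      by (subst integral_T) (auto intro!: bounded_fun_intros simp: S_def ac_simps)
    then show "(S x y)\<^sup>2 \<le> (\<integral>w. (T (\<lambda>u. g x u * g y u) w)\<^sup>2 \<partial>M)"
      by (simp only:) (intro jensen_square bounded_fun_intros; measurable)
  qed
  finally show ?thesis .
qed

text \<open>The kernel \<open>T\<^sup>3 - T deg \<otimes> T deg\<close> is positive definite by \<open>Q_ge\<close>, so by the Schur
  property its product with \<open>g\<close> is as well. This replaces the two edges of the house
  opposite to the roof by pendant paths.\<close>

lemma house_ge:
  "1 \<le> (\<integral>r. \<integral>a. \<integral>a'. g r a * g a a' * g r a' * (\<integral>b. g a b * T (g a') b \<partial>M) \<partial>M \<partial>M \<partial>M)"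
proof -
  define R where "R a a' = (\<integral>b. g a b * T (g a') b \<partial>M) - T deg a * T deg a'" for a a'
  have R [measurable (raw)]: "(\<lambda>p. R (a p) (b p)) \<in> borel_measurable N"
    if [measurable]: "a \<in> N \<rightarrow>\<^sub>M M" "b \<in> N \<rightarrow>\<^sub>M M" for a b and N :: "'c measure"
    unfolding R_def by measurable
  have bR: "bounded_fun (\<lambda>p. R (a p) (b p))" for a b :: "'c \<Rightarrow> 'a"
    unfolding R_def by (intro bounded_fun_intros)
  have "psd_kernel M R"
    unfolding psd_kernel_def
  proof (intro allI impI)
    fix \<phi> :: "'a \<Rightarrow> real"
    assume [measurable]: "\<phi> \<in> borel_measurable M" and bd: "bounded_fun \<phi>"
    note bd' = bd[THEN bounded_fun_comp]
    have *: "(\<integral>y. \<phi> x * R x y * \<phi> y \<partial>M) = \<phi> x * T (T (T \<phi>)) x - \<phi> x * T deg x * (\<integral>y. T deg y * \<phi> y \<partial>M)"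
      if [measurable]: "x \<in> space M" for x
    proof -
      have "(\<integral>y. (\<integral>b. g x b * T (g y) b \<partial>M) * \<phi> y \<partial>M) = (\<integral>y. (\<integral>b. g x b * T (g y) b * \<phi> y \<partial>M) \<partial>M)"
        by simp
      also have "\<dots> = (\<integral>b. (\<integral>y. g x b * T (g y) b * \<phi> y \<partial>M) \<partial>M)"
        by (intro integral_swap) (auto simp: case_prod_beta' intro!: bounded_fun_intros bd')
      also have "\<dots> = (\<integral>b. g x b * T (T \<phi>) b \<partial>M)"
      proof (intro Bochner_Integration.integral_cong refl)
        fix b assume "b \<in> space M"
        then have "(\<integral>y. T (g b) y * \<phi> y \<partial>M) = T (T \<phi>) b"
          by (intro integral_row_T bd) measurable
        then show "(\<integral>y. g x b * T (g y) b * \<phi> y \<partial>M) = g x b * T (T \<phi>) b"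
          by (simp add: T_row_sym[of _ b] mult.assoc)
      qed
      finally have "(\<integral>y. (\<integral>b. g x b * T (g y) b \<partial>M) * \<phi> y \<partial>M) = T (T (T \<phi>)) x"
        by (simp add: T_def[of "T (T \<phi>)"])
      moreover have "(\<integral>y. \<phi> x * R x y * \<phi> y \<partial>M) = (\<integral>y. \<phi> x * ((\<integral>b. g x b * T (g y) b \<partial>M) * \<phi> y) -
          \<phi> x * T deg x * (T deg y * \<phi> y) \<partial>M)"
        by (simp add: R_def algebra_simps)
      moreover have "\<dots> = \<phi> x * (\<integral>y. (\<integral>b. g x b * T (g y) b \<partial>M) * \<phi> y \<partial>M) -
          \<phi> x * T deg x * (\<integral>y. T deg y * \<phi> y \<partial>M)"
        by (subst Bochner_Integration.integral_diff;
          (intro integrable_bounded_fun bounded_fun_intros bd'; measurable)?) simp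
      ultimately show ?thesis by simp
    qed
    \<comment> \<open>Cauchy--Schwarz for \<open>T \<phi>\<close>. Moving \<open>T\<close> to the
      other factor turns the two sides into the two parts of the form of \<open>R\<close>.\<close>
    have "(\<integral>x. T \<phi> x * deg x \<partial>M)\<^sup>2 \<le> Q (T \<phi>)"
      by (intro Q_ge bounded_fun_intros bd') measurable
    moreover have "(\<integral>x. T \<phi> x * deg x \<partial>M) = (\<integral>y. T deg y * \<phi> y \<partial>M)"
      by (subst T_self_adjoint[symmetric]) (auto intro!: bounded_fun_intros bd simp: mult.commute)
    moreover have "Q (T \<phi>) = (\<integral>x. \<phi> x * T (T (T \<phi>)) x \<partial>M)"
      unfolding Q_def by (intro T_self_adjoint[symmetric] bounded_fun_intros bd bd') measurable
    moreover have "(\<integral>x. \<integral>y. \<phi> x * R x y * \<phi> y \<partial>M \<partial>M) =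
        (\<integral>x. \<phi> x * T (T (T \<phi>)) x \<partial>M) - (\<integral>y. T deg y * \<phi> y \<partial>M)\<^sup>2"
      by (subst Bochner_Integration.integral_cong[OF refl *], assumption)
        (simp add: integrable_bounded_fun bounded_fun_intros bd bd' power2_eq_square mult.commute)
    ultimately show "0 \<le> (\<integral>x. \<integral>y. \<phi> x * R x y * \<phi> y \<partial>M \<partial>M)" by simp
  qed
  then have psd: "psd_kernel M (\<lambda>x y. R x y * g x y)"
    by (intro schur) (auto simp: case_prod_beta' intro!: bounded_fun_intros bR)
  \<comment> \<open>Once both crossing edges are replaced, each half of the house, with the roof
    \<open>r\<close> as an endpoint, is a fork.\<close>
  have "(\<integral>x. T (\<lambda>y. T deg y * deg y) x \<partial>M) = (\<integral>x. (deg x)\<^sup>2 * T deg x \<partial>M)"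
    by (subst integral_T) (auto intro!: bounded_fun_intros simp: power2_eq_square ac_simps)
  then have "1 \<le> (\<integral>x. (T (\<lambda>y. T deg y * deg y) x)\<^sup>2 \<partial>M)"
    using fork_ge
    by (intro jensen_power bounded_fun_intros T_nonneg mult_nonneg_nonneg deg_nonneg) auto
  also have "\<dots> \<le> (\<integral>r. Q (\<lambda>a. g r a * T deg a) \<partial>M)"
    by (intro integral_mono integrable_bounded_fun bounded_fun_intros Q_row_ge; measurable)
  also have "\<dots> \<le> (\<integral>r. \<integral>a. \<integral>a'. g r a * g a a' * g r a' * (\<integral>b. g a b * T (g a') b \<partial>M) \<partial>M \<partial>M \<partial>M)"
  proof (intro integral_mono integrable_bounded_fun bounded_fun_intros; measurable?)
    fix r assume [measurable]: "r \<in> space M"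
    \<comment> \<open>The test function \<open>g r\<close> supplies the two edges at the
      roof.\<close>
    have "0 \<le> (\<integral>a. \<integral>a'. g r a * (R a a' * g a a') * g r a' \<partial>M \<partial>M)"
      using psd[unfolded psd_kernel_def, rule_format, of "g r"] by (simp add: bounded_fun_intros)
    also have "\<dots> = (\<integral>a. (\<integral>a'. g r a * g a a' * g r a' * (\<integral>b. g a b * T (g a') b \<partial>M) \<partial>M) -
        g r a * T deg a * T (\<lambda>a. g r a * T deg a) a \<partial>M)"
    proof (intro Bochner_Integration.integral_cong refl)
      fix a assume [measurable]: "a \<in> space M"
      have "(\<integral>a'. g r a * (R a a' * g a a') * g r a' \<partial>M) =
          (\<integral>a'. g r a * g a a' * g r a' * (\<integral>b. g a b * T (g a') b \<partial>M) -
            g r a * T deg a * (g a a' * (g r a' * T deg a')) \<partial>M)"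
        by (simp add: R_def algebra_simps)
      also have "\<dots> = (\<integral>a'. g r a * g a a' * g r a' * (\<integral>b. g a b * T (g a') b \<partial>M) \<partial>M) -
        g r a * T deg a * T (\<lambda>a. g r a * T deg a) a"
        unfolding T_def[of "\<lambda>a. g r a * T deg a" a]
        by (subst Bochner_Integration.integral_diff;
          (intro integrable_bounded_fun bounded_fun_intros; measurable)?) simp
      finally show "(\<integral>a'. g r a * (R a a' * g a a') * g r a' \<partial>M) = \<dots>" .
    qed
    also have "\<dots> = (\<integral>a. (\<integral>a'. g r a * g a a' * g r a' * (\<integral>b. g a b * T (g a') b \<partial>M) \<partial>M) \<partial>M) -
        Q (\<lambda>a. g r a * T deg a)"
      unfolding Q_def
      by (subst Bochner_Integration.integral_diff;
          (intro integrable_bounded_fun bounded_fun_intros; measurable)?) simp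
    finally show "Q (\<lambda>a. g r a * T deg a) \<le>
        (\<integral>a. \<integral>a'. g r a * g a a' * g r a' * (\<integral>b. g a b * T (g a') b \<partial>M) \<partial>M \<partial>M)"
      by simp
  qed
  finally show ?thesis .
qed

end

section \<open>Graph densities\<close>

definition edge_prod :: "(real \<Rightarrow> real \<Rightarrow> real) \<Rightarrow> 'v set set \<Rightarrow> ('v \<Rightarrow> real) \<Rightarrow> real" where
  "edge_prod g E x = (\<Prod>e\<in>E. edge_factor (case_prod g) x e)"

definition graph_density :: "real measure \<Rightarrow> 'v set \<Rightarrow> 'v set set \<Rightarrow> (real \<Rightarrow> real \<Rightarrow> real) \<Rightarrow> real" where
  "graph_density M V E g = (\<integral>x. edge_prod g E x \<partial>Pi\<^sub>M V (\<lambda>_. M))"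

text \<open>The measure is quantified together with the kernel because the cone construction uses
  goodness of the base for a measure with a density.\<close>

definition dnn_good :: "'v set \<Rightarrow> 'v set set \<Rightarrow> bool" where
  "dnn_good V E \<longleftrightarrow> (\<forall>M g. dnn_kernel M g \<longrightarrow>
     dnn_kernel.edge_density M g ^ card E \<le> graph_density M V E g)"

lemma edge_factor_doubleton:
  assumes "\<And>a b. g a b = g b a" "u \<noteq> v"
  shows "edge_factor (case_prod g) x {u, v} = g (x u) (x v)"
  unfolding edge_factor_def using assms
  by (intro the_equality) (auto simp: doubleton_eq_iff)

lemma finite_simple_graph_edgeE:
  assumes "finite_simple_graph V E" "e \<in> E"
  obtains u v where "e = {u, v}" "u \<noteq> v" "u \<in> V" "v \<in> V"
proof -
  have "card e = 2" "e \<subseteq> V"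
    using assms unfolding finite_simple_graph_def by auto
  then show ?thesis
    using that by (auto simp: card_2_iff)
qed

lemma finite_simple_graph_finite_edges: "finite_simple_graph V E \<Longrightarrow> finite E"
  unfolding finite_simple_graph_def by (auto intro: finite_subset[of E "Pow V"])

lemma (in prob_space) prob_space_PiM': "prob_space (Pi\<^sub>M V (\<lambda>_. M))"
  by (intro prob_space_PiM) (rule prob_space_axioms)

lemma (in prob_space) integral_PiM_insert:
  fixes f :: "('v \<Rightarrow> 'a) \<Rightarrow> real"
  assumes "finite V" "v \<notin> V"
    and f: "f \<in> borel_measurable (Pi\<^sub>M (insert v V) (\<lambda>_. M))" and bd: "bounded_fun f"
  shows "(\<integral>x. f x \<partial>Pi\<^sub>M (insert v V) (\<lambda>_. M)) = (\<integral>y. \<integral>x. f (x(v := y)) \<partial>Pi\<^sub>M V (\<lambda>_. M) \<partial>M)"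
proof -
  interpret PP: product_prob_space "\<lambda>_. M" by unfold_locales
  interpret V: prob_space "Pi\<^sub>M V (\<lambda>_. M)" by (rule prob_space_PiM')
  interpret W: prob_space "Pi\<^sub>M (insert v V) (\<lambda>_. M)" by (rule prob_space_PiM')
  interpret P: pair_prob_space "Pi\<^sub>M V (\<lambda>_. M)" M ..
  have "(\<integral>x. f x \<partial>Pi\<^sub>M (insert v V) (\<lambda>_. M)) = (\<integral>x. \<integral>y. f (x(v := y)) \<partial>M \<partial>Pi\<^sub>M V (\<lambda>_. M))"
    using assms by (intro PP.product_integral_insert W.integrable_bounded_fun)
  also have "\<dots> = (\<integral>y. \<integral>x. f (x(v := y)) \<partial>Pi\<^sub>M V (\<lambda>_. M) \<partial>M)"
    using measurable_compose[OF measurable_add_dim f] bounded_fun_comp[OF bd]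
    by (intro P.Fubini_integral[symmetric] P.integrable_bounded_fun) (auto simp: case_prod_beta')
  finally show ?thesis .
qed

section \<open>Change of measure by a density\<close>

lemma (in prob_space) integral_density_bounded:
  fixes F :: "'a \<Rightarrow> real"
  assumes "f \<in> borel_measurable M" "\<And>x. 0 \<le> f x" "F \<in> borel_measurable M"
  shows "(\<integral>x. F x \<partial>density M (\<lambda>x. ennreal (f x))) = (\<integral>x. f x * F x \<partial>M)"
  using assms by (simp add: integral_density)

lemma (in prob_space) prob_space_density:
  assumes "f \<in> borel_measurable M" "\<And>x. 0 \<le> f x" "bounded_fun f" "(\<integral>x. f x \<partial>M) = 1"
  shows "prob_space (density M (\<lambda>x. ennreal (f x)))"
proof
  have "emeasure (density M f) (space M) = (\<integral>\<^sup>+x. ennreal (f x) \<partial>M)"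
    using assms by (subst emeasure_density) (auto intro!: nn_integral_cong)
  also have "\<dots> = 1"
    using assms by (subst nn_integral_eq_integral) (auto intro: integrable_bounded_fun)
  finally show "emeasure (density M f) (space (density M f)) = 1" by simp
qed

lemma (in prob_space) integral_PiM_density:
  fixes F :: "('v \<Rightarrow> 'a) \<Rightarrow> real"
  assumes "finite W"
    and f: "f \<in> borel_measurable M" "\<And>x. 0 \<le> f x" "bounded_fun f" "(\<integral>x. f x \<partial>M) = 1"
    and "F \<in> borel_measurable (Pi\<^sub>M W (\<lambda>_. M))" "bounded_fun F"
  shows "(\<integral>x. F x \<partial>Pi\<^sub>M W (\<lambda>_. density M (\<lambda>x. ennreal (f x)))) =
    (\<integral>x. (\<Prod>u\<in>W. f (x u)) * F x \<partial>Pi\<^sub>M W (\<lambda>_. M))"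
  using assms(1,6,7)
proof (induction W arbitrary: F)
  case empty
  show ?case by (simp add: PiM_empty)
next
  case (insert v W)
  note [measurable] = f(1) insert.prems(1)
  let ?D = "density M (\<lambda>x. ennreal (f x))"
  interpret D: prob_space ?D by (rule prob_space_density[OF f])
  interpret W: prob_space "Pi\<^sub>M W (\<lambda>_. ?D)" by (rule D.prob_space_PiM')
  have sets_D: "sets (Pi\<^sub>M J (\<lambda>_. ?D)) = sets (Pi\<^sub>M J (\<lambda>_. M))" for J :: "'v set"
    by (intro sets_PiM_cong) auto
  note bd = bounded_fun_comp[OF insert.prems(2)] bounded_fun_comp[OF f(3)]
  have upd: "(\<lambda>p. F ((snd p)(v := fst p))) \<in> borel_measurable (M \<Otimes>\<^sub>M Pi\<^sub>M W (\<lambda>_. M))"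
    by measurable
  have "(\<integral>x. F x \<partial>Pi\<^sub>M (insert v W) (\<lambda>_. ?D)) = (\<integral>y. \<integral>x. F (x(v := y)) \<partial>Pi\<^sub>M W (\<lambda>_. ?D) \<partial>?D)"
    using insert by (intro D.integral_PiM_insert) (auto simp: measurable_cong_sets[OF sets_D refl])
  also have "\<dots> = (\<integral>y. f y * (\<integral>x. F (x(v := y)) \<partial>Pi\<^sub>M W (\<lambda>_. ?D)) \<partial>M)"
  proof (intro integral_density_bounded f)
    have "(\<lambda>p. F ((snd p)(v := fst p))) \<in> borel_measurable (M \<Otimes>\<^sub>M Pi\<^sub>M W (\<lambda>_. ?D))"
      using upd by (subst measurable_cong_sets[OF sets_pair_measure_cong[OF refl sets_D] refl])
    then show "(\<lambda>y. \<integral>x. F (x(v := y)) \<partial>Pi\<^sub>M W (\<lambda>_. ?D)) \<in> borel_measurable M"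
      by (intro W.borel_measurable_lebesgue_integral) (simp add: case_prod_beta')
  qed
  also have "\<dots> = (\<integral>y. f y * (\<integral>x. (\<Prod>u\<in>W. f (x u)) * F (x(v := y)) \<partial>Pi\<^sub>M W (\<lambda>_. M)) \<partial>M)"
  proof (rule Bochner_Integration.integral_cong[OF refl])
    fix y assume [measurable]: "y \<in> space M"
    have "(\<integral>x. F (x(v := y)) \<partial>Pi\<^sub>M W (\<lambda>_. ?D)) =
        (\<integral>x. (\<Prod>u\<in>W. f (x u)) * F (x(v := y)) \<partial>Pi\<^sub>M W (\<lambda>_. M))"
      by (intro insert.IH bd) measurable
    then show "f y * (\<integral>x. F (x(v := y)) \<partial>Pi\<^sub>M W (\<lambda>_. ?D)) =
        f y * (\<integral>x. (\<Prod>u\<in>W. f (x u)) * F (x(v := y)) \<partial>Pi\<^sub>M W (\<lambda>_. M))"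
      by simp
  qed
  also have "\<dots> = (\<integral>y. \<integral>x. (\<Prod>u\<in>insert v W. f ((x(v := y)) u)) * F (x(v := y)) \<partial>Pi\<^sub>M W (\<lambda>_. M) \<partial>M)"
  proof (intro Bochner_Integration.integral_cong refl)
    fix y
    have "(\<Prod>u\<in>W. f ((x(v := y)) u)) = (\<Prod>u\<in>W. f (x u))" for x
      using insert.hyps by (intro prod.cong) auto
    then have "(\<Prod>u\<in>insert v W. f ((x(v := y)) u)) = f y * (\<Prod>u\<in>W. f (x u))" for x
      using insert.hyps by simp
    then show "f y * (\<integral>x. (\<Prod>u\<in>W. f (x u)) * F (x(v := y)) \<partial>Pi\<^sub>M W (\<lambda>_. M)) =
        (\<integral>x. (\<Prod>u\<in>insert v W. f ((x(v := y)) u)) * F (x(v := y)) \<partial>Pi\<^sub>M W (\<lambda>_. M))"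
      by (simp add: mult.assoc)
  qed
  also have "\<dots> = (\<integral>x. (\<Prod>u\<in>insert v W. f (x u)) * F x \<partial>Pi\<^sub>M (insert v W) (\<lambda>_. M))"
    using insert.hyps
    by (intro integral_PiM_insert[symmetric] bounded_fun_intros bd insert.prems(2)) auto
  finally show ?case .
qed

text \<open>A form over the new measure is the form over \<open>M\<close> of the kernel multiplied
  by \<open>f x * f y\<close>. So the Schur property for \<open>R\<close> over the new measure is
  the old one for \<open>f x * R x y * f y\<close>.\<close>

lemma (in dnn_kernel) dnn_kernel_density:
  assumes f: "f \<in> borel_measurable M" "\<And>x. 0 \<le> f x" "bounded_fun f" "(\<integral>x. f x \<partial>M) = 1"
  shows "dnn_kernel (density M (\<lambda>x. ennreal (f x))) g"
proof -
  let ?D = "density M (\<lambda>x. ennreal (f x))"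
  interpret D: prob_space ?D by (rule prob_space_density[OF f])
  note [measurable] = f(1)
  have sets_D: "sets (?D \<Otimes>\<^sub>M ?D) = sets (M \<Otimes>\<^sub>M M)"
    by (intro sets_pair_measure_cong) auto
  have D: "(\<integral>x. \<integral>y. K x y \<partial>?D \<partial>?D) = (\<integral>x. \<integral>y. f x * K x y * f y \<partial>M \<partial>M)"
    if [measurable]: "(\<lambda>(x, y). K x y) \<in> borel_measurable (M \<Otimes>\<^sub>M M)" for K
  proof -
    have "(\<integral>x. \<integral>y. K x y \<partial>?D \<partial>?D) = (\<integral>x. f x * (\<integral>y. K x y \<partial>?D) \<partial>M)"
    proof (intro integral_density_bounded f)
      have "(\<lambda>(x, y). K x y) \<in> borel_measurable (M \<Otimes>\<^sub>M ?D)"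
        using that by (subst measurable_cong_sets[OF sets_pair_measure_cong refl]) auto
      then show "(\<lambda>x. \<integral>y. K x y \<partial>?D) \<in> borel_measurable M"
        by (rule D.borel_measurable_lebesgue_integral)
    qed
    also have "\<dots> = (\<integral>x. f x * (\<integral>y. f y * K x y \<partial>M) \<partial>M)"
      by (intro Bochner_Integration.integral_cong refl arg_cong2[where f = "(*)"]
        integral_density_bounded f) measurable
    finally show ?thesis
      by (simp add: ac_simps flip: integral_mult_right_zero)
  qed
  show ?thesis
  proof
    show "(\<lambda>(x, y). g x y) \<in> borel_measurable (?D \<Otimes>\<^sub>M ?D)"
      using g_measurable by (simp add: measurable_cong_sets[OF sets_D refl])
    fix R
    assume R: "(\<lambda>(x, y). R x y) \<in> borel_measurable (?D \<Otimes>\<^sub>M ?D)"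
      and bd: "bounded_fun (\<lambda>(x, y). R x y)" and psd: "psd_kernel ?D R"
    have R' [measurable]: "(\<lambda>(x, y). R x y) \<in> borel_measurable (M \<Otimes>\<^sub>M M)"
      using R by (simp add: measurable_cong_sets[OF sets_D refl])
    note bd' = f(3)[THEN bounded_fun_comp]
      bounded_fun_comp[OF bd, where k = "\<lambda>p. (a p, b p)" for a b, simplified]
    have "psd_kernel M (\<lambda>x y. f x * R x y * f y)"
      unfolding psd_kernel_def
    proof (intro allI impI)
      fix \<phi> :: "'a \<Rightarrow> real"
      assume \<phi>: "\<phi> \<in> borel_measurable M" "bounded_fun \<phi>"
      note [measurable] = \<phi>(1)
      have "(\<integral>x. \<integral>y. \<phi> x * (f x * R x y * f y) * \<phi> y \<partial>M \<partial>M) = (\<integral>x. \<integral>y. \<phi> x * R x y * \<phi> y \<partial>?D \<partial>?D)"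
        by (subst D) (auto simp: ac_simps)
      also have "\<dots> \<ge> 0"
        using psd \<phi> unfolding psd_kernel_def by simp
      finally show "0 \<le> (\<integral>x. \<integral>y. \<phi> x * (f x * R x y * f y) * \<phi> y \<partial>M \<partial>M)" .
    qed
    then have *: "psd_kernel M (\<lambda>x y. f x * R x y * f y * g x y)"
      by (intro schur) (auto simp: case_prod_beta' intro!: bounded_fun_intros bd')
    show "psd_kernel ?D (\<lambda>x y. R x y * g x y)"
      unfolding psd_kernel_def
    proof (intro allI impI)
      fix \<phi> :: "'a \<Rightarrow> real"
      assume \<phi>: "\<phi> \<in> borel_measurable ?D" "bounded_fun \<phi>"
      then have [measurable]: "\<phi> \<in> borel_measurable M" by simp
      have "(\<integral>x. \<integral>y. \<phi> x * (R x y * g x y) * \<phi> y \<partial>?D \<partial>?D) =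
          (\<integral>x. \<integral>y. \<phi> x * (f x * R x y * f y * g x y) * \<phi> y \<partial>M \<partial>M)"
        by (subst D) (auto simp: ac_simps)
      then show "0 \<le> (\<integral>x. \<integral>y. \<phi> x * (R x y * g x y) * \<phi> y \<partial>?D \<partial>?D)"
        using * \<phi> unfolding psd_kernel_def by simp
    qed
  qed (auto intro: g_bounded g_nonneg g_sym)
qed

context dnn_kernel
begin

lemma normalized_dnn_kernel_scale:
  assumes "0 < edge_density"
  shows "normalized_dnn_kernel M (\<lambda>x y. g x y / edge_density)"
proof -
  let ?p = edge_density
  interpret S: dnn_kernel M "\<lambda>x y. g x y / ?p"
  proof
    show "(\<lambda>(x, y). g x y / ?p) \<in> borel_measurable (M \<Otimes>\<^sub>M M)" by measurable
    show "bounded_fun (\<lambda>(x, y). g x y / ?p)"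
      unfolding divide_inverse case_prod_beta' by (intro bounded_fun_intros)
    show "0 \<le> g x y / ?p" "g x y / ?p = g y x / ?p" for x y
      using assms g_nonneg g_sym by auto
    fix R :: "'a \<Rightarrow> 'a \<Rightarrow> real"
    assume "(\<lambda>(x, y). R x y) \<in> borel_measurable (M \<Otimes>\<^sub>M M)" "bounded_fun (\<lambda>(x, y). R x y)" "psd_kernel M R"
    then have psd: "psd_kernel M (\<lambda>x y. R x y * g x y)" by (rule schur)
    have "(\<integral>x. \<integral>y. \<phi> x * (R x y * (g x y / ?p)) * \<phi> y \<partial>M \<partial>M) =
        (\<integral>x. \<integral>y. \<phi> x * (R x y * g x y) * \<phi> y \<partial>M \<partial>M) / ?p" for \<phi>
      by (simp add: times_divide_eq_right times_divide_eq_left)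
    then show "psd_kernel M (\<lambda>x y. R x y * (g x y / ?p))"
      using psd assms unfolding psd_kernel_def by simp
  qed
  show ?thesis
  proof
    show "S.edge_density = 1"
      using assms unfolding S.edge_density_def S.deg_def
      by (simp add: edge_density_def deg_def)
  qed
qed

lemma edge_density_nonneg: "0 \<le> edge_density"
  unfolding edge_density_def using deg_nonneg by (intro integral_nonneg_AE) auto

end

lemma edge_prod_nonneg:
  assumes "dnn_kernel M g" "finite_simple_graph V E"
  shows "0 \<le> edge_prod g E x"
  unfolding edge_prod_def
proof (rule prod_nonneg)
  interpret dnn_kernel M g by fact
  fix e assume "e \<in> E"
  then obtain u v where "e = {u, v}" "u \<noteq> v"
    using assms(2) by (elim finite_simple_graph_edgeE)
  then show "0 \<le> edge_factor (case_prod g) x e"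
    by (simp add: edge_factor_doubleton g_sym g_nonneg)
qed

lemma edge_prod_measurable:
  assumes "dnn_kernel M g" "finite_simple_graph V E" and k: "k \<in> N \<rightarrow>\<^sub>M Pi\<^sub>M V (\<lambda>_. M)"
  shows "(\<lambda>p. edge_prod g E (k p)) \<in> borel_measurable N"
  unfolding edge_prod_def
proof (rule borel_measurable_prod)
  interpret dnn_kernel M g by fact
  fix e assume "e \<in> E"
  then obtain u v where e: "e = {u, v}" "u \<noteq> v" "u \<in> V" "v \<in> V"
    using assms(2) by (elim finite_simple_graph_edgeE)
  have [measurable]: "(\<lambda>p. k p w) \<in> N \<rightarrow>\<^sub>M M" if "w \<in> V" for w
    using measurable_compose[OF k measurable_component_singleton[OF that]] .
  show "(\<lambda>p. edge_factor (case_prod g) (k p) e) \<in> borel_measurable N"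
    using e by (simp add: edge_factor_doubleton g_sym)
qed

lemma edge_prod_bounded:
  assumes "dnn_kernel M g" "finite_simple_graph V E"
  shows "bounded_fun (\<lambda>p. edge_prod g E (k p))"
  unfolding edge_prod_def
proof (rule bounded_fun_prod)
  interpret dnn_kernel M g by fact
  fix e assume "e \<in> E"
  then obtain u v where e: "e = {u, v}" "u \<noteq> v"
    using assms(2) by (elim finite_simple_graph_edgeE)
  show "bounded_fun (\<lambda>p. edge_factor (case_prod g) (k p) e)"
    using e by (simp add: edge_factor_doubleton g_sym bounded_fun_intros)
qed

lemma edge_prod_cong:
  assumes "finite_simple_graph V E" "\<And>v. v \<in> V \<Longrightarrow> x v = y v"
  shows "edge_prod g E x = edge_prod g E y"
  unfolding edge_prod_def
proof (rule prod.cong[OF refl])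
  fix e assume "e \<in> E"
  then have "e \<subseteq> V"
    using assms(1) unfolding finite_simple_graph_def by auto
  then have "(r = case_prod g (x u, x v)) = (r = case_prod g (y u, y v))" if "e = {u, v}" for r u v
    using that assms(2) by simp
  then show "edge_factor (case_prod g) x e = edge_factor (case_prod g) y e"
    unfolding edge_factor_def by (intro arg_cong[where f = The] ext) blast
qed

lemma graph_density_nonneg:
  assumes "dnn_kernel M g" "finite_simple_graph V E"
  shows "0 \<le> graph_density M V E g"
  unfolding graph_density_def using edge_prod_nonneg[OF assms] by (intro integral_nonneg_AE) auto

lemma dnn_good_empty: "dnn_good V {}"
  unfolding dnn_good_def
proof (intro allI impI)
  fix M and g :: "real \<Rightarrow> real \<Rightarrow> real"
  assume "dnn_kernel M g"
  then interpret dnn_kernel M g .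
  interpret V: prob_space "Pi\<^sub>M V (\<lambda>_. M)" by (rule prob_space_PiM')
  show "edge_density ^ card {} \<le> graph_density M V {} g"
    by (simp add: graph_density_def edge_prod_def V.prob_space)
qed

text \<open>Both sides are homogeneous of degree \<open>card E\<close>, so \<open>g\<close> may be
  divided by its edge density. If that density is 0, the bound is 0 as soon as there is an edge,
  which is why the edgeless graph is split off.\<close>

lemma dnn_goodI:
  assumes G: "finite_simple_graph V E"
    and *: "\<And>M g. normalized_dnn_kernel M g \<Longrightarrow> 1 \<le> graph_density M V E g"
  shows "dnn_good V E"
proof (cases "E = {}")
  case False
  have fin: "finite E" using G by (rule finite_simple_graph_finite_edges)
  show ?thesis
    unfolding dnn_good_def
  proof (intro allI impI)
    fix M and g :: "real \<Rightarrow> real \<Rightarrow> real"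
    assume M: "dnn_kernel M g"
    then interpret dnn_kernel M g .
    show "edge_density ^ card E \<le> graph_density M V E g"
    proof (cases "edge_density = 0")
      case True
      then show ?thesis
        using False fin graph_density_nonneg[OF M G] by (simp add: power_0_left)
    next
      case False
      then have p: "0 < edge_density"
        using edge_density_nonneg by simp
      have "edge_prod (\<lambda>x y. g x y / edge_density) E x = edge_prod g E x / edge_density ^ card E" for x
      proof -
        have "edge_prod (\<lambda>x y. g x y / edge_density) E x =
          (\<Prod>e\<in>E. edge_factor (case_prod g) x e / edge_density)"
          unfolding edge_prod_def
        proof (intro prod.cong refl)
          fix e assume "e \<in> E"
          then obtain u v where e: "e = {u, v}" "u \<noteq> v"
            using G by (elim finite_simple_graph_edgeE)
          then show "edge_factor (\<lambda>(x, y). g x y / edge_density) x e =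
              edge_factor (case_prod g) x e / edge_density"
            using g_sym edge_factor_doubleton[of "\<lambda>x y. g x y / edge_density" u v x]
            by (simp add: edge_factor_doubleton)
        qed
        then show ?thesis
          by (simp add: edge_prod_def prod_dividef)
      qed
      then have "edge_prod (\<lambda>x y. g x y / edge_density) E = (\<lambda>x. edge_prod g E x / edge_density ^ card E)"
        by (rule ext)
      then have eq: "graph_density M V E (\<lambda>x y. g x y / edge_density) =
          graph_density M V E g / edge_density ^ card E"
        unfolding graph_density_def by (simp only: integral_divide_zero)
      then show ?thesis
        using *[OF normalized_dnn_kernel_scale[OF p]] p by (simp add: eq le_divide_eq)
    qed
  qed
qed (use dnn_good_empty in simp)

lemma dnn_good_Un:
  assumes "dnn_good V1 E1" "dnn_good V2 E2" "V1 \<inter> V2 = {}"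
    and G1: "finite_simple_graph V1 E1" and G2: "finite_simple_graph V2 E2"
  shows "dnn_good (V1 \<union> V2) (E1 \<union> E2)"
  unfolding dnn_good_def
proof (intro allI impI)
  fix M and g :: "real \<Rightarrow> real \<Rightarrow> real"
  assume M: "dnn_kernel M g"
  then interpret dnn_kernel M g .
  interpret PP: product_prob_space "\<lambda>_. M" by unfold_locales
  interpret V: prob_space "Pi\<^sub>M (V1 \<union> V2) (\<lambda>_. M)" by (rule prob_space_PiM')
  have fin: "finite V1" "finite V2" "finite E1" "finite E2"
    using G1 G2 finite_simple_graph_finite_edges by (auto simp: finite_simple_graph_def)
  have G: "finite_simple_graph (V1 \<union> V2) (E1 \<union> E2)"
    using G1 G2 by (auto simp: finite_simple_graph_def)
  have disj: "E1 \<inter> E2 = {}"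
    using assms(3) finite_simple_graph_edgeE[OF G1] finite_simple_graph_edgeE[OF G2]
    by (metis disjoint_iff doubleton_eq_iff)
  have split: "edge_prod g (E1 \<union> E2) (merge V1 V2 (x, y)) = edge_prod g E1 x * edge_prod g E2 y" for x y
  proof -
    have "edge_prod g (E1 \<union> E2) z = edge_prod g E1 z * edge_prod g E2 z" for z
      unfolding edge_prod_def using fin disj by (rule_tac prod.union_disjoint)
    moreover have "edge_prod g E1 (merge V1 V2 (x, y)) = edge_prod g E1 x"
      by (rule edge_prod_cong[OF G1]) (simp add: merge_def)
    moreover have "edge_prod g E2 (merge V1 V2 (x, y)) = edge_prod g E2 y"
      using assms(3) by (intro edge_prod_cong[OF G2]) (auto simp: merge_def)
    ultimately show ?thesis by simp
  qed
  have "graph_density M (V1 \<union> V2) (E1 \<union> E2) g =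
      (\<integral>x. \<integral>y. edge_prod g (E1 \<union> E2) (merge V1 V2 (x, y)) \<partial>Pi\<^sub>M V2 (\<lambda>_. M) \<partial>Pi\<^sub>M V1 (\<lambda>_. M))"
    unfolding graph_density_def using assms(3) fin
    by (intro PP.product_integral_fold V.integrable_bounded_fun edge_prod_bounded[OF M G]
      edge_prod_measurable[OF M G]) auto
  then have eq: "graph_density M (V1 \<union> V2) (E1 \<union> E2) g = graph_density M V1 E1 g * graph_density M V2 E2 g"
    by (simp add: graph_density_def split)
  have "edge_density ^ card (E1 \<union> E2) = edge_density ^ card E1 * edge_density ^ card E2"
    using fin disj by (simp add: card_Un_disjoint power_add)
  also have "\<dots> \<le> graph_density M V1 E1 g * graph_density M V2 E2 g"
    using assms(1,2) M graph_density_nonneg[OF M G1] edge_density_nonneg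
    unfolding dnn_good_def by (intro mult_mono) auto
  finally show "edge_density ^ card (E1 \<union> E2) \<le> graph_density M (V1 \<union> V2) (E1 \<union> E2) g"
    using eq by simp
qed

section \<open>Cones\<close>

text \<open>The weights of two neighbours of \<open>z\<close> together with the edge between them
  form the triangle density rooted at \<open>z\<close>, and \<open>triangle_row_ge\<close> bounds it
  below.\<close>

lemma (in dnn_kernel) edge_density_row_ge:
  assumes z [measurable]: "z \<in> space M" and pos: "0 < deg z"
  shows "dnn_kernel (density M (\<lambda>x. ennreal (g z x / deg z))) g"
    and "dnn_kernel.edge_density (density M (\<lambda>x. ennreal (g z x / deg z))) g = Q (g z) / (deg z)\<^sup>2"
proof -
  let ?f = "\<lambda>x. g z x / deg z"
  let ?D = "density M (\<lambda>x. ennreal (?f x))"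
  have f: "?f \<in> borel_measurable M" "\<And>x. 0 \<le> ?f x" "bounded_fun ?f" "(\<integral>x. ?f x \<partial>M) = 1"
    using pos g_nonneg unfolding divide_inverse
    by (auto intro!: bounded_fun_intros simp: deg_def[symmetric])
  show D: "dnn_kernel ?D g"
    by (rule dnn_kernel_density[OF f])
  then interpret D: dnn_kernel ?D g .
  have deg: "D.deg x = T (g z) x / deg z" if [measurable]: "x \<in> space M" for x
    unfolding D.deg_def T_def
    by (subst integral_density_bounded[OF f(1,2)]) (auto simp: mult.commute)
  have "D.edge_density = (\<integral>x. ?f x * D.deg x \<partial>M)"
    unfolding D.edge_density_def
    using D.deg_measurable[of "\<lambda>x. x" ?D] by (intro integral_density_bounded[OF f(1,2)]) simp
  also have "\<dots> = (\<integral>x. g z x * T (g z) x / (deg z)\<^sup>2 \<partial>M)"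
    by (intro Bochner_Integration.integral_cong refl) (simp add: deg power2_eq_square)
  finally show "D.edge_density = Q (g z) / (deg z)\<^sup>2"
    by (simp add: Q_def)
qed

lemma dnn_good_cone:
  assumes H: "dnn_good W E" "finite_simple_graph W E" and z: "z \<notin> W"
  shows "dnn_good (insert z W) ((\<lambda>u. {z, u}) ` W \<union> E)"
proof (rule dnn_goodI)
  have finW: "finite W" and finE: "finite E"
    using H(2) finite_simple_graph_finite_edges by (auto simp: finite_simple_graph_def)
  show G: "finite_simple_graph (insert z W) ((\<lambda>u. {z, u}) ` W \<union> E)"
    using H(2) z by (auto simp: finite_simple_graph_def card_2_iff)
  fix M and g :: "real \<Rightarrow> real \<Rightarrow> real"
  assume "normalized_dnn_kernel M g"
  then interpret normalized_dnn_kernel M g .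
  have M: "dnn_kernel M g" ..
  let ?G = "(\<lambda>u. {z, u}) ` W \<union> E"
  let ?P = "Pi\<^sub>M W (\<lambda>_. M)"
  interpret P: prob_space ?P by (rule prob_space_PiM')
  \<comment> \<open>The density of the cone conditional on the apex being at
    \<open>y\<close>.\<close>
  define Y where "Y y = (\<integral>x. (\<Prod>u\<in>W. g y (x u)) * edge_prod g E x \<partial>?P)" for y
  have "(\<lambda>y. \<integral>x. (\<Prod>u\<in>W. g y (x u)) * edge_prod g E x \<partial>?P) \<in> borel_measurable M"
    by (intro P.borel_measurable_lebesgue_integral)
      (auto simp: case_prod_beta' intro!: borel_measurable_times borel_measurable_prod g_measurable'
        edge_prod_measurable[OF M H(2)])
  then have Ym [measurable]: "Y \<in> borel_measurable M"
    by (simp add: Y_def[abs_def])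
  have bY: "bounded_fun Y"
    unfolding Y_def[abs_def]
    by (intro P.bounded_fun_integral bounded_fun_intros edge_prod_bounded[OF M H(2)])
  have Y_nonneg: "0 \<le> Y y" for y
    unfolding Y_def
    by (intro integral_nonneg_AE AE_I2 mult_nonneg_nonneg prod_nonneg g_nonneg edge_prod_nonneg[OF M H(2)])
  have density: "graph_density M (insert z W) ?G g = (\<integral>y. Y y \<partial>M)"
  proof -
    have "edge_prod g ?G (x(z := y)) = (\<Prod>u\<in>W. g y (x u)) * edge_prod g E x" for x y
    proof -
      have "(\<lambda>u. {z, u}) ` W \<inter> E = {}"
        using H(2) z by (auto simp: finite_simple_graph_def)
      moreover have "inj_on (\<lambda>u. {z, u}) W"
        using z by (auto simp: inj_on_def doubleton_eq_iff)
      moreover have "edge_factor (case_prod g) (x(z := y)) {z, u} = g y (x u)" if "u \<in> W" for u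
        using that z by (subst edge_factor_doubleton) (auto simp: g_sym)
      moreover have "edge_prod g E (x(z := y)) = edge_prod g E x"
        using z by (intro edge_prod_cong[OF H(2)]) auto
      ultimately show ?thesis
        unfolding edge_prod_def using finW finE
        by (simp add: prod.union_disjoint prod.reindex cong: prod.cong)
    qed
    then show ?thesis
      unfolding graph_density_def Y_def using finW z
      by (subst integral_PiM_insert) (auto intro: edge_prod_measurable[OF M G] edge_prod_bounded[OF M G])
  qed
  have Y_ge: "deg y ^ card W * (T deg y / deg y) ^ (2 * card E) \<le> Y y"
    if y [measurable]: "y \<in> space M" and pos: "0 < deg y" for y
  proof -
    let ?f = "\<lambda>x. g y x / deg y"
    let ?D = "density M (\<lambda>x. ennreal (?f x))"
    have f: "?f \<in> borel_measurable M" "\<And>x. 0 \<le> ?f x" "bounded_fun ?f" "(\<integral>x. ?f x \<partial>M) = 1"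
      using pos g_nonneg unfolding divide_inverse
      by (auto intro!: bounded_fun_intros simp: deg_def[symmetric])
    have "(T deg y / deg y) ^ (2 * card E) = ((T deg y)\<^sup>2 / (deg y)\<^sup>2) ^ card E"
      by (simp add: power_mult power_divide)
    also have "\<dots> \<le> (Q (g y) / (deg y)\<^sup>2) ^ card E"
      using triangle_row_ge[OF y] by (intro power_mono divide_right_mono) auto
    also have "\<dots> \<le> graph_density ?D W E g"
      using H(1) edge_density_row_ge[OF y pos] unfolding dnn_good_def by metis
    also have "\<dots> = (\<integral>x. (\<Prod>u\<in>W. ?f (x u)) * edge_prod g E x \<partial>?P)"
      unfolding graph_density_def
      by (intro integral_PiM_density finW f edge_prod_bounded[OF M H(2)] edge_prod_measurable[OF M H(2)])
        measurable
    also have "\<dots> = Y y / deg y ^ card W"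
      by (simp add: Y_def prod_dividef)
    finally show ?thesis
      using pos by (simp add: field_simps)
  qed
  show "1 \<le> graph_density M (insert z W) ?G g"
  \<comment> \<open>The cone over an edgeless graph is a star, treated by a moment of
    \<open>deg\<close>; the exponent \<open>s\<close> of the other case has
    \<open>2 * card E\<close> as denominator.\<close>
  proof (cases "E = {}")
    case True
    have le: "deg y ^ card W \<le> Y y" if "y \<in> space M" for y
    proof (cases "deg y = 0 \<and> W \<noteq> {}")
      case False
      then consider "W = {}" | "0 < deg y"
        using deg_nonneg[of y] by fastforce
      then show ?thesis
      proof cases
        case 1
        then show ?thesis using True by (simp add: Y_def edge_prod_def PiM_empty)
      next
        case 2
        then show ?thesis using Y_ge[OF that] True by simp
      qed
    qed (use finW Y_nonneg[of y] in \<open>auto simp: power_0_left\<close>)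
    have "1 \<le> (\<integral>y. deg y ^ card W \<partial>M)"
      by (intro jensen_power deg_nonneg bounded_fun_intros) (auto simp: integral_deg)
    also have "\<dots> \<le> (\<integral>y. Y y \<partial>M)"
      by (intro integral_mono integrable_bounded_fun bounded_fun_intros bY le) measurable
    finally show ?thesis by (simp add: density)
  next
    case False
    then obtain u where "u \<in> W"
      using H(2) by (metis all_not_in_conv finite_simple_graph_edgeE)
    then have W: "0 < card W" using finW by (auto simp: card_gt_0_iff)
    define k where "k = 2 * card E"
    have k: "0 < k" using False finE by (simp add: k_def card_gt_0_iff)
    define s where "s = (real (card W) - 1) / real k"
    have s: "0 \<le> s" using W k by (simp add: s_def)
    \<comment> \<open>Bernoulli's inequality for \<open>T deg y * deg y powr s / deg y\<close>; the exponent \<open>s\<close> is chosen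
      so that its \<open>k\<close>-th power, multiplied by \<open>deg y\<close>, is the bound in \<open>Y_ge\<close>.\<close>
    have le: "real k * (deg y powr s * T deg y) \<le> Y y + (real k - 1) * deg y" if y: "y \<in> space M" for y
    proof (cases "deg y = 0")
      case True
      then show ?thesis using Y_nonneg by simp
    next
      case False
      then have pos: "0 < deg y" using deg_nonneg[of y] by simp
      let ?t = "deg y powr s * T deg y / deg y"
      have t: "0 \<le> ?t" using pos T_nonneg[OF deg_nonneg] by simp
      have "(deg y powr s) ^ k = deg y powr (real (card W) - 1)"
        using pos k by (simp add: s_def powr_powr flip: powr_realpow)
      also have "\<dots> = deg y ^ (card W - 1)"
        using pos W by (simp flip: powr_realpow)
      finally have eq: "(deg y powr s) ^ k = deg y ^ (card W - 1)" .
      have "deg y * (1 + real k * (?t - 1)) \<le> deg y * ?t ^ k"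
        using Bernoulli_inequality[of "?t - 1" k] t pos by (intro mult_left_mono) auto
      also have "?t ^ k = deg y ^ (card W - 1) * (T deg y / deg y) ^ k"
        by (simp add: eq power_mult_distrib power_divide)
      also have "deg y * (deg y ^ (card W - 1) * (T deg y / deg y) ^ k) =
          deg y ^ card W * (T deg y / deg y) ^ k"
        using W by (cases "card W") auto
      also have "\<dots> \<le> Y y"
        using Y_ge[OF y pos] by (simp add: k_def)
      finally show ?thesis
        using pos by (simp add: algebra_simps)
    qed
    \<comment> \<open>Integrating the pointwise bound: as \<open>deg\<close> has mean 1, the
      correction terms contribute exactly \<open>k - 1\<close>, and at least 1 remains for
      \<open>Y\<close>.\<close>
    have "real k \<le> real k * (\<integral>y. deg y powr s * T deg y \<partial>M)"
      using integral_deg_powr_T_deg_ge[OF s] k by simp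
    also have "\<dots> = (\<integral>y. real k * (deg y powr s * T deg y) \<partial>M)"
      by simp
    also have "\<dots> \<le> (\<integral>y. Y y + (real k - 1) * deg y \<partial>M)"
      by (intro integral_mono integrable_bounded_fun bounded_fun_intros bounded_fun_deg_powr bY le s) measurable
    also have "\<dots> = (\<integral>y. Y y \<partial>M) + (real k - 1)"
      by (simp add: integrable_bounded_fun bounded_fun_intros bY integral_deg)
    finally show ?thesis by (simp add: density)
  qed
qed

section \<open>The twelve connected graphs without a dominating vertex\<close>

lemma (in prob_space) fun_upd_borel_measurable:
  assumes "f \<in> borel_measurable (Pi\<^sub>M (insert v V) (\<lambda>_. M))" "y \<in> space M"
  shows "(\<lambda>x. f (x(v := y))) \<in> borel_measurable (Pi\<^sub>M V (\<lambda>_. M))"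
  using assms by measurable

text \<open>The inner integrand comes with its measurability and boundedness as assumptions, so the
  rule can be applied again to it, down to the empty product.\<close>

lemma (in prob_space) integral_PiM_insert_cong:
  fixes f :: "('v \<Rightarrow> 'a) \<Rightarrow> real"
  assumes "finite V" "v \<notin> V" "f \<in> borel_measurable (Pi\<^sub>M (insert v V) (\<lambda>_. M))" "bounded_fun f"
    and "\<And>y. \<lbrakk>(\<lambda>x. f (x(v := y))) \<in> borel_measurable (Pi\<^sub>M V (\<lambda>_. M)); bounded_fun (\<lambda>x. f (x(v := y)))\<rbrakk>
      \<Longrightarrow> (\<integral>x. f (x(v := y)) \<partial>Pi\<^sub>M V (\<lambda>_. M)) = h y"
  shows "(\<integral>x. f x \<partial>Pi\<^sub>M (insert v V) (\<lambda>_. M)) = (\<integral>y. h y \<partial>M)"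
  unfolding integral_PiM_insert[OF assms(1-4)]
proof (rule Bochner_Integration.integral_cong[OF refl])
  fix y assume "y \<in> space M"
  then show "(\<integral>x. f (x(v := y)) \<partial>Pi\<^sub>M V (\<lambda>_. M)) = h y"
    by (intro assms(5) fun_upd_borel_measurable[OF assms(3)] bounded_fun_comp[OF assms(4)])
qed

lemma integral_PiM_empty: "(\<integral>x. f x \<partial>Pi\<^sub>M {} M) = (f (\<lambda>_. undefined) :: real)"
  by (simp add: PiM_empty lebesgue_integral_count_space_finite)

text \<open>The first vertex of the list becomes the outermost integral. This dictates the order in
  which the vertices of each graph below are listed.\<close>

lemma graph_density_4:
  assumes M: "dnn_kernel M g" and "distinct [a, b, c, d]" and G: "finite_simple_graph {a, b, c, d} E"
  shows "graph_density M {a, b, c, d} E g =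
    (\<integral>x. \<integral>y. \<integral>z. \<integral>w. edge_prod g E ((\<lambda>_. undefined)(d := w, c := z, b := y, a := x)) \<partial>M \<partial>M \<partial>M \<partial>M)"
proof -
  interpret dnn_kernel M g by fact
  note m = edge_prod_measurable[OF M G measurable_ident_sets[OF refl]] and bd = edge_prod_bounded[OF M G, of "\<lambda>x. x"]
  show ?thesis
    unfolding graph_density_def using assms(2)
    by (intro integral_PiM_insert_cong m bd; (assumption | simp add: integral_PiM_empty))
qed

lemma graph_density_5:
  assumes M: "dnn_kernel M g" and "distinct [a, b, c, d, e]"
    and G: "finite_simple_graph {a, b, c, d, e} E"
  shows "graph_density M {a, b, c, d, e} E g =
    (\<integral>x. \<integral>y. \<integral>z. \<integral>w. \<integral>v.
      edge_prod g E ((\<lambda>_. undefined)(e := v, d := w, c := z, b := y, a := x)) \<partial>M \<partial>M \<partial>M \<partial>M \<partial>M)"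
proof -
  interpret dnn_kernel M g by fact
  note m = edge_prod_measurable[OF M G measurable_ident_sets[OF refl]] and bd = edge_prod_bounded[OF M G, of "\<lambda>x. x"]
  show ?thesis
    unfolding graph_density_def using assms(2)
    by (intro integral_PiM_insert_cong m bd; (assumption | simp add: integral_PiM_empty))
qed

text \<open>The vertices are ordered like the nested integrals of \<open>path4_ge\<close>, and the
  integrand is written as that inequality reads once all its factors stand under the integrals. The
  next eleven lemmas follow the same pattern.\<close>

lemma dnn_good_path4:
  assumes d: "distinct [a, b, c, d]"
  shows "dnn_good {a, b, c, d} {{a, b}, {b, c}, {a, d}}"
    (is "dnn_good ?V ?E")
proof (rule dnn_goodI)
  show G: "finite_simple_graph ?V ?E"
    using d by (auto simp: finite_simple_graph_def)
  fix M and g :: "real \<Rightarrow> real \<Rightarrow> real"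
  assume "normalized_dnn_kernel M g"
  then interpret normalized_dnn_kernel M g .
  note ge = path4_ge[unfolded T_def Q_def deg_def power2_eq_square power3_eq_cube]
  have "graph_density M ?V ?E g = (\<integral>a. \<integral>b. \<integral>c. \<integral>d. g a d * (g a b * g b c) \<partial>M \<partial>M \<partial>M \<partial>M)"
    \<comment> \<open>Distinctness of the reversed list supplies every disequality in its other
      orientation.\<close>
    unfolding graph_density_4[OF dnn_kernel_axioms d G] using d distinct_rev[THEN iffD2, OF d]
    by (simp add: edge_prod_def doubleton_eq_iff edge_factor_doubleton g_sym ac_simps
      del: integral_mult_right_zero integral_mult_left_zero)
  then show "1 \<le> graph_density M ?V ?E g"
    using ge by (simp flip: integral_mult_right_zero integral_mult_left_zero)
qed

lemma dnn_good_cycle4: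
  assumes d: "distinct [a, b, c, d]"
  shows "dnn_good {a, b, c, d} {{a, c}, {b, c}, {a, d}, {b, d}}"
    (is "dnn_good ?V ?E")
proof (rule dnn_goodI)
  show G: "finite_simple_graph ?V ?E"
    using d by (auto simp: finite_simple_graph_def)
  fix M and g :: "real \<Rightarrow> real \<Rightarrow> real"
  assume "normalized_dnn_kernel M g"
  then interpret normalized_dnn_kernel M g .
  note ge = cycle4_ge[unfolded T_def Q_def deg_def power2_eq_square power3_eq_cube]
  have "graph_density M ?V ?E g = (\<integral>a. \<integral>b. \<integral>c. \<integral>d. g b d * g a d * (g b c * g a c) \<partial>M \<partial>M \<partial>M \<partial>M)"
    unfolding graph_density_4[OF dnn_kernel_axioms d G] using d distinct_rev[THEN iffD2, OF d]
    by (simp add: edge_prod_def doubleton_eq_iff edge_factor_doubleton g_sym ac_simps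
      del: integral_mult_right_zero integral_mult_left_zero)
  then show "1 \<le> graph_density M ?V ?E g"
    using ge by (simp flip: integral_mult_right_zero integral_mult_left_zero)
qed

lemma dnn_good_path5:
  assumes d: "distinct [a, b, c, d, e]"
  shows "dnn_good {a, b, c, d, e} {{a, b}, {b, c}, {a, d}, {d, e}}"
    (is "dnn_good ?V ?E")
proof (rule dnn_goodI)
  show G: "finite_simple_graph ?V ?E"
    using d by (auto simp: finite_simple_graph_def)
  fix M and g :: "real \<Rightarrow> real \<Rightarrow> real"
  assume "normalized_dnn_kernel M g"
  then interpret normalized_dnn_kernel M g .
  note ge = path5_ge[unfolded T_def Q_def deg_def power2_eq_square power3_eq_cube]
  have "graph_density M ?V ?E g = (\<integral>a. \<integral>b. \<integral>c. \<integral>d. \<integral>e. g a d * g d e * (g a b * g b c) \<partial>M \<partial>M \<partial>M \<partial>M \<partial>M)"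
    unfolding graph_density_5[OF dnn_kernel_axioms d G] using d distinct_rev[THEN iffD2, OF d]
    by (simp add: edge_prod_def doubleton_eq_iff edge_factor_doubleton g_sym ac_simps
      del: integral_mult_right_zero integral_mult_left_zero)
  then show "1 \<le> graph_density M ?V ?E g"
    using ge by (simp flip: integral_mult_right_zero integral_mult_left_zero)
qed

lemma dnn_good_fork:
  assumes d: "distinct [a, b, c, d, e]"
  shows "dnn_good {a, b, c, d, e} {{a, d}, {a, e}, {a, b}, {b, c}}"
    (is "dnn_good ?V ?E")
proof (rule dnn_goodI)
  show G: "finite_simple_graph ?V ?E"
    using d by (auto simp: finite_simple_graph_def)
  fix M and g :: "real \<Rightarrow> real \<Rightarrow> real"
  assume "normalized_dnn_kernel M g"
  then interpret normalized_dnn_kernel M g .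
  note ge = fork_ge[unfolded T_def Q_def deg_def power2_eq_square power3_eq_cube]
  have "graph_density M ?V ?E g = (\<integral>a. \<integral>b. \<integral>c. \<integral>d. \<integral>e. g a e * g a d * (g a b * g b c) \<partial>M \<partial>M \<partial>M \<partial>M \<partial>M)"
    unfolding graph_density_5[OF dnn_kernel_axioms d G] using d distinct_rev[THEN iffD2, OF d]
    by (simp add: edge_prod_def doubleton_eq_iff edge_factor_doubleton g_sym ac_simps
      del: integral_mult_right_zero integral_mult_left_zero)
  then show "1 \<le> graph_density M ?V ?E g"
    using ge by (simp flip: integral_mult_right_zero integral_mult_left_zero)
qed

lemma dnn_good_cycle5:
  assumes d: "distinct [a, b, c, d, e]"
  shows "dnn_good {a, b, c, d, e} {{b, e}, {a, e}, {b, c}, {c, d}, {a, d}}"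
    (is "dnn_good ?V ?E")
proof (rule dnn_goodI)
  show G: "finite_simple_graph ?V ?E"
    using d by (auto simp: finite_simple_graph_def)
  fix M and g :: "real \<Rightarrow> real \<Rightarrow> real"
  assume "normalized_dnn_kernel M g"
  then interpret normalized_dnn_kernel M g .
  note ge = cycle5_ge[unfolded T_def Q_def deg_def power2_eq_square power3_eq_cube]
  have "graph_density M ?V ?E g = (\<integral>a. \<integral>b. \<integral>c. \<integral>d. \<integral>e. g b e * g a e * (g b c * (g c d * g a d)) \<partial>M \<partial>M \<partial>M \<partial>M \<partial>M)"
    unfolding graph_density_5[OF dnn_kernel_axioms d G] using d distinct_rev[THEN iffD2, OF d]
    by (simp add: edge_prod_def doubleton_eq_iff edge_factor_doubleton g_sym ac_simps
      del: integral_mult_right_zero integral_mult_left_zero)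
  then show "1 \<le> graph_density M ?V ?E g"
    using ge by (simp flip: integral_mult_right_zero integral_mult_left_zero)
qed

lemma dnn_good_banner:
  assumes d: "distinct [a, b, c, d, e]"
  shows "dnn_good {a, b, c, d, e} {{a, e}, {b, d}, {a, d}, {b, c}, {a, c}}"
    (is "dnn_good ?V ?E")
proof (rule dnn_goodI)
  show G: "finite_simple_graph ?V ?E"
    using d by (auto simp: finite_simple_graph_def)
  fix M and g :: "real \<Rightarrow> real \<Rightarrow> real"
  assume "normalized_dnn_kernel M g"
  then interpret normalized_dnn_kernel M g .
  note ge = banner_ge[unfolded T_def Q_def deg_def power2_eq_square power3_eq_cube]
  have "graph_density M ?V ?E g = (\<integral>a. \<integral>b. \<integral>c. \<integral>d. \<integral>e. g a e * (g b d * g a d * (g b c * g a c)) \<partial>M \<partial>M \<partial>M \<partial>M \<partial>M)"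
    unfolding graph_density_5[OF dnn_kernel_axioms d G] using d distinct_rev[THEN iffD2, OF d]
    by (simp add: edge_prod_def doubleton_eq_iff edge_factor_doubleton g_sym ac_simps
      del: integral_mult_right_zero integral_mult_left_zero)
  then show "1 \<le> graph_density M ?V ?E g"
    using ge by (simp flip: integral_mult_right_zero integral_mult_left_zero)
qed

lemma dnn_good_tadpole:
  assumes d: "distinct [a, b, c, d, e]"
  shows "dnn_good {a, b, c, d, e} {{a, d}, {d, e}, {a, b}, {b, c}, {a, c}}"
    (is "dnn_good ?V ?E")
proof (rule dnn_goodI)
  show G: "finite_simple_graph ?V ?E"
    using d by (auto simp: finite_simple_graph_def)
  fix M and g :: "real \<Rightarrow> real \<Rightarrow> real"
  assume "normalized_dnn_kernel M g"
  then interpret normalized_dnn_kernel M g .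
  note ge = tadpole_ge[unfolded T_def Q_def deg_def power2_eq_square power3_eq_cube]
  have "graph_density M ?V ?E g = (\<integral>a. \<integral>b. \<integral>c. \<integral>d. \<integral>e. g a d * g d e * (g a b * (g b c * g a c)) \<partial>M \<partial>M \<partial>M \<partial>M \<partial>M)"
    unfolding graph_density_5[OF dnn_kernel_axioms d G] using d distinct_rev[THEN iffD2, OF d]
    by (simp add: edge_prod_def doubleton_eq_iff edge_factor_doubleton g_sym ac_simps
      del: integral_mult_right_zero integral_mult_left_zero)
  then show "1 \<le> graph_density M ?V ?E g"
    using ge by (simp flip: integral_mult_right_zero integral_mult_left_zero)
qed

lemma dnn_good_bull:
  assumes d: "distinct [a, b, c, d, e]"
  shows "dnn_good {a, b, c, d, e} {{a, b}, {b, e}, {b, c}, {a, c}, {c, d}}"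
    (is "dnn_good ?V ?E")
proof (rule dnn_goodI)
  show G: "finite_simple_graph ?V ?E"
    using d by (auto simp: finite_simple_graph_def)
  fix M and g :: "real \<Rightarrow> real \<Rightarrow> real"
  assume "normalized_dnn_kernel M g"
  then interpret normalized_dnn_kernel M g .
  note ge = bull_ge[unfolded T_def Q_def deg_def power2_eq_square power3_eq_cube]
  have "graph_density M ?V ?E g = (\<integral>a. \<integral>b. \<integral>c. \<integral>d. \<integral>e. g a b * g b e * (g b c * (g a c * g c d)) \<partial>M \<partial>M \<partial>M \<partial>M \<partial>M)"
    unfolding graph_density_5[OF dnn_kernel_axioms d G] using d distinct_rev[THEN iffD2, OF d]
    by (simp add: edge_prod_def doubleton_eq_iff edge_factor_doubleton g_sym ac_simps
      del: integral_mult_right_zero integral_mult_left_zero)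
  then show "1 \<le> graph_density M ?V ?E g"
    using ge by (simp flip: integral_mult_right_zero integral_mult_left_zero)
qed

lemma dnn_good_K23:
  assumes d: "distinct [a, b, c, d, e]"
  shows "dnn_good {a, b, c, d, e} {{a, c}, {a, d}, {a, e}, {b, c}, {b, d}, {b, e}}"
    (is "dnn_good ?V ?E")
proof (rule dnn_goodI)
  show G: "finite_simple_graph ?V ?E"
    using d by (auto simp: finite_simple_graph_def)
  fix M and g :: "real \<Rightarrow> real \<Rightarrow> real"
  assume "normalized_dnn_kernel M g"
  then interpret normalized_dnn_kernel M g .
  note ge = K23_ge[unfolded T_def Q_def deg_def power2_eq_square power3_eq_cube]
  have "graph_density M ?V ?E g = (\<integral>a. \<integral>b. \<integral>c. \<integral>d. \<integral>e. g b e * g a e * (g b d * g a d) * (g b c * g a c) \<partial>M \<partial>M \<partial>M \<partial>M \<partial>M)"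
    unfolding graph_density_5[OF dnn_kernel_axioms d G] using d distinct_rev[THEN iffD2, OF d]
    by (simp add: edge_prod_def doubleton_eq_iff edge_factor_doubleton g_sym ac_simps
      del: integral_mult_right_zero integral_mult_left_zero)
  then show "1 \<le> graph_density M ?V ?E g"
    using ge by (simp flip: integral_mult_right_zero integral_mult_left_zero)
qed

text \<open>A diamond on \<open>a\<close>, \<open>b\<close>, \<open>c\<close>, \<open>d\<close> with
  a pendant edge at \<open>a\<close>, one of its two nonadjacent vertices. At \<open>c\<close> or
  \<open>d\<close> the pendant edge would create a dominating vertex.\<close>

lemma dnn_good_kite:
  assumes d: "distinct [a, b, c, d, e]"
  shows "dnn_good {a, b, c, d, e} {{a, e}, {a, c}, {b, c}, {c, d}, {a, d}, {b, d}}"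
    (is "dnn_good ?V ?E")
proof (rule dnn_goodI)
  show G: "finite_simple_graph ?V ?E"
    using d by (auto simp: finite_simple_graph_def)
  fix M and g :: "real \<Rightarrow> real \<Rightarrow> real"
  assume "normalized_dnn_kernel M g"
  then interpret normalized_dnn_kernel M g .
  note ge = kite_ge[unfolded T_def Q_def deg_def power2_eq_square power3_eq_cube]
  have "graph_density M ?V ?E g = (\<integral>a. \<integral>b. \<integral>c. \<integral>d. \<integral>e. g a e * (g a c * g b c * (g c d * (g a d * g b d))) \<partial>M \<partial>M \<partial>M \<partial>M \<partial>M)"
    unfolding graph_density_5[OF dnn_kernel_axioms d G] using d distinct_rev[THEN iffD2, OF d]
    by (simp add: edge_prod_def doubleton_eq_iff edge_factor_doubleton g_sym ac_simps
      del: integral_mult_right_zero integral_mult_left_zero)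
  then show "1 \<le> graph_density M ?V ?E g"
    using ge by (simp flip: integral_mult_right_zero integral_mult_left_zero)
qed

text \<open>The extra edge lies in the side of size three. Joining \<open>d\<close> and
  \<open>e\<close> instead would make both of them dominating.\<close>

lemma dnn_good_K23_plus_edge:
  assumes d: "distinct [a, b, c, d, e]"
  shows "dnn_good {a, b, c, d, e} {{a, b}, {c, d}, {a, d}, {b, d}, {c, e}, {a, e}, {b, e}}"
    (is "dnn_good ?V ?E")
proof (rule dnn_goodI)
  show G: "finite_simple_graph ?V ?E"
    using d by (auto simp: finite_simple_graph_def)
  fix M and g :: "real \<Rightarrow> real \<Rightarrow> real"
  assume "normalized_dnn_kernel M g"
  then interpret normalized_dnn_kernel M g .
  note ge = K23_plus_edge_ge[unfolded T_def Q_def deg_def power2_eq_square power3_eq_cube]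
  have "graph_density M ?V ?E g = (\<integral>a. \<integral>b. \<integral>c. \<integral>d. \<integral>e. g a b * (g c e * (g a e * g b e) * (g c d * (g a d * g b d))) \<partial>M \<partial>M \<partial>M \<partial>M \<partial>M)"
    unfolding graph_density_5[OF dnn_kernel_axioms d G] using d distinct_rev[THEN iffD2, OF d]
    by (simp add: edge_prod_def doubleton_eq_iff edge_factor_doubleton g_sym ac_simps
      del: integral_mult_right_zero integral_mult_left_zero)
  then show "1 \<le> graph_density M ?V ?E g"
    using ge by (simp flip: integral_mult_right_zero integral_mult_left_zero)
qed

lemma dnn_good_house:
  assumes d: "distinct [a, b, c, d, e]"
  shows "dnn_good {a, b, c, d, e} {{a, b}, {b, c}, {a, c}, {b, d}, {d, e}, {c, e}}"
    (is "dnn_good ?V ?E")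
proof (rule dnn_goodI)
  show G: "finite_simple_graph ?V ?E"
    using d by (auto simp: finite_simple_graph_def)
  fix M and g :: "real \<Rightarrow> real \<Rightarrow> real"
  assume "normalized_dnn_kernel M g"
  then interpret normalized_dnn_kernel M g .
  note ge = house_ge[unfolded T_def Q_def deg_def power2_eq_square power3_eq_cube]
  have "graph_density M ?V ?E g = (\<integral>a. \<integral>b. \<integral>c. \<integral>d. \<integral>e. g a b * g b c * g a c * (g b d * (g d e * g c e)) \<partial>M \<partial>M \<partial>M \<partial>M \<partial>M)"
    unfolding graph_density_5[OF dnn_kernel_axioms d G] using d distinct_rev[THEN iffD2, OF d]
    by (simp add: edge_prod_def doubleton_eq_iff edge_factor_doubleton g_sym ac_simps
      del: integral_mult_right_zero integral_mult_left_zero)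
  then show "1 \<le> graph_density M ?V ?E g"
    using ge by (simp flip: integral_mult_right_zero integral_mult_left_zero)
qed

section \<open>Graphs with at most five vertices\<close>

lemma dnn_good_dominating:
  assumes G: "finite_simple_graph V E" and z: "z \<in> V" "\<And>u. u \<in> V \<Longrightarrow> u \<noteq> z \<Longrightarrow> {z, u} \<in> E"
    and IH: "dnn_good (V - {z}) {e \<in> E. z \<notin> e}"
  shows "dnn_good V E"
proof -
  have "finite_simple_graph (V - {z}) {e \<in> E. z \<notin> e}"
    using G by (auto simp: finite_simple_graph_def)
  then have "dnn_good (insert z (V - {z})) ((\<lambda>u. {z, u}) ` (V - {z}) \<union> {e \<in> E. z \<notin> e})"
    by (intro dnn_good_cone IH) auto
  moreover have "(\<lambda>u. {z, u}) ` (V - {z}) \<union> {e \<in> E. z \<notin> e} = E"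
    using z by (fastforce elim: finite_simple_graph_edgeE[OF G])
  ultimately show ?thesis
    using z by (simp add: insert_absorb)
qed

lemma dnn_good_disconnected:
  assumes G: "finite_simple_graph V E" and S: "S \<subseteq> V"
    and no_edge: "\<And>x y. x \<in> S \<Longrightarrow> y \<in> V - S \<Longrightarrow> {x, y} \<notin> E"
    and IH: "dnn_good S {e \<in> E. e \<subseteq> S}" "dnn_good (V - S) {e \<in> E. e \<subseteq> V - S}"
  shows "dnn_good V E"
proof -
  have "finite_simple_graph S {e \<in> E. e \<subseteq> S}" "finite_simple_graph (V - S) {e \<in> E. e \<subseteq> V - S}"
    using G S by (auto simp: finite_simple_graph_def intro: finite_subset)
  then have "dnn_good (S \<union> (V - S)) ({e \<in> E. e \<subseteq> S} \<union> {e \<in> E. e \<subseteq> V - S})"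
    by (intro dnn_good_Un IH) auto
  moreover have "e \<subseteq> S \<or> e \<subseteq> V - S" if "e \<in> E" for e
  proof -
    obtain x y where e: "e = {x, y}" "x \<in> V" "y \<in> V"
      using \<open>e \<in> E\<close> by (elim finite_simple_graph_edgeE[OF G])
    then show ?thesis
      using no_edge[of x y] no_edge[of y x] \<open>e \<in> E\<close> by (auto simp: insert_commute)
  qed
  then have "{e \<in> E. e \<subseteq> S} \<union> {e \<in> E. e \<subseteq> V - S} = E" by auto
  ultimately show ?thesis
    using S by (simp add: Un_absorb1)
qed

section \<open>Classification of the connected graphs without a dominating vertex\<close>

context
  fixes V :: "'v set" and E :: "'v set set" and P :: "'v \<Rightarrow> 'v \<Rightarrow> bool"
  assumes G: "finite_simple_graph V E"
    and P: "\<And>x y. P x y \<longleftrightarrow> {x, y} \<in> E"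
    and nodom: "\<And>z. z \<in> V \<Longrightarrow> \<exists>u\<in>V. u \<noteq> z \<and> \<not> P z u"
    and conn: "\<And>S. S \<subseteq> V \<Longrightarrow> S \<noteq> {} \<Longrightarrow> S \<noteq> V \<Longrightarrow> \<exists>x\<in>S. \<exists>y\<in>V - S. P x y"
begin

lemma P_sym: "P x y \<longleftrightarrow> P y x"
  by (simp add: P insert_commute)

text \<open>Each unordered pair is listed in one orientation, so once every atom
  \<open>P x y\<close> is decided the simplifier evaluates \<open>E\<close> to an explicit edge
  set.\<close>

lemma edges_UN:
  assumes "E \<subseteq> (\<lambda>(x, y). {x, y}) ` L"
  shows "E = (\<Union>(x, y)\<in>L. if P x y then {{x, y}} else {})"
proof -
  have "E = {e \<in> (\<lambda>(x, y). {x, y}) ` L. e \<in> E}"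
    using assms by blast
  also have "\<dots> = (\<Union>(x, y)\<in>L. if P x y then {{x, y}} else {})"
    by (auto simp: P split: if_splits)
  finally show ?thesis .
qed

lemma edges_4:
  assumes "V = {a, b, c, d}"
  shows "E = (\<Union>(x, y)\<in>{(a, b), (a, c), (a, d), (b, c), (b, d), (c, d)}. if P x y then {{x, y}} else {})"
proof (rule edges_UN)
  have "e \<in> E \<Longrightarrow> e \<in> {{a, b}, {a, c}, {a, d}, {b, c}, {b, d}, {c, d}}" for e
    unfolding assms by (erule finite_simple_graph_edgeE[OF G[unfolded assms]];
      elim insertE emptyE; simp add: doubleton_eq_iff)
  then show "E \<subseteq> (\<lambda>(x, y). {x, y}) ` {(a, b), (a, c), (a, d), (b, c), (b, d), (c, d)}"
    by (intro subsetI) (simp only: image_insert image_empty case_prod_conv)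
qed

lemma edges_5:
  assumes "V = {a, b, c, d, e}"
  shows "E = (\<Union>(x, y)\<in>{(a, b), (a, c), (a, d), (a, e), (b, c), (b, d), (b, e), (c, d), (c, e), (d, e)}.
    if P x y then {{x, y}} else {})"
proof (rule edges_UN)
  have "f \<in> E \<Longrightarrow> f \<in> {{a, b}, {a, c}, {a, d}, {a, e}, {b, c}, {b, d}, {b, e}, {c, d}, {c, e}, {d, e}}" for f
    unfolding assms by (erule finite_simple_graph_edgeE[OF G[unfolded assms]];
      elim insertE emptyE; simp add: doubleton_eq_iff)
  then show "E \<subseteq> (\<lambda>(x, y). {x, y}) ` {(a, b), (a, c), (a, d), (a, e), (b, c), (b, d), (b, e),
      (c, d), (c, e), (d, e)}"
    by (intro subsetI) (simp only: image_insert image_empty case_prod_conv)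
qed

text \<open>If \<open>a\<close> and \<open>b\<close> were adjacent, whichever of them is joined to
  \<open>w\<close> would dominate. So they are not, and the neighbours of \<open>w\<close> decide
  between the cycle and the path.\<close>

lemma dnn_good_4:
  assumes V: "V = {v, a, b, w}" and d: "distinct [v, a, b, w]"
    and "P v a" "P v b" "\<not> P v w"
  shows "dnn_good V E"
proof -
  have "\<not> (P a b \<and> P a w)" "\<not> (P a b \<and> P b w)"
    using nodom[of a] nodom[of b] assms by (auto simp: P_sym)
  moreover have "P a w \<or> P b w"
    using conn[of "{w}"] assms by (auto simp: P_sym)
  ultimately consider "P a w" "P b w" "\<not> P a b" | "P a w" "\<not> P b w" "\<not> P a b" | "P b w" "\<not> P a w" "\<not> P a b"
    by blast
  then show ?thesis
  proof cases
    case 1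
    then show ?thesis
      using dnn_good_cycle4[of v w a b] d distinct_rev[THEN iffD2, OF d] assms by (subst edges_4[OF V]) (simp add: insert_commute)
  next
    case 2
    then show ?thesis
      using dnn_good_path4[of v a w b] d distinct_rev[THEN iffD2, OF d] assms by (subst edges_4[OF V]) (simp add: insert_commute)
  next
    case 3
    then show ?thesis
      using dnn_good_path4[of v b w a] d distinct_rev[THEN iffD2, OF d] assms by (subst edges_4[OF V]) (simp add: insert_commute)
  qed
qed

text \<open>Maximum degree two makes \<open>b\<close>, \<open>v\<close>, \<open>a\<close>,
  \<open>c\<close> a path with saturated inner vertices. An edge between its ends would close a
  4-cycle and isolate \<open>w\<close>, so \<open>w\<close> is joined to one end or to both.\<close>

lemma dnn_good_5_degree_2:
  assumes V: "V = {v, a, b, c, w}" and d: "distinct [v, a, b, c, w]"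
    and P1: "P v a" "P v b" "\<not> P v c" "\<not> P v w" "\<not> P a b" "P a c"
    and deg: "\<And>z p q r. distinct [p, q, r] \<Longrightarrow> P z p \<Longrightarrow> P z q \<Longrightarrow> \<not> P z r"
  shows "dnn_good V E"
proof -
  have "\<not> P a w"
    using deg[of v c w a] P1 d by (auto simp: P_sym)
  moreover have "P b w \<or> P c w"
    using conn[of "{w}"] V d P1 \<open>\<not> P a w\<close> by (auto simp: P_sym)
  moreover have "\<not> (P b w \<and> P b c)"
    using deg[of v c w b] P1 d by (auto simp: P_sym)
  moreover have "\<not> (P c w \<and> P b c)"
    using deg[of a w b c] P1 d by (auto simp: P_sym)
  ultimately consider "\<not> P a w" "\<not> P b c" "P b w" "P c w"
    | "\<not> P a w" "\<not> P b c" "P b w" "\<not> P c w" | "\<not> P a w" "\<not> P b c" "\<not> P b w" "P c w"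
    by blast
  then show ?thesis
  proof cases
    case 1
    then show ?thesis
      using dnn_good_cycle5[of v c w b a] d distinct_rev[THEN iffD2, OF d] P1
      by (subst edges_5[OF V], subst V) (simp add: insert_commute)
  next
    case 2
    then show ?thesis
      using dnn_good_path5[of v a c b w] d distinct_rev[THEN iffD2, OF d] P1
      by (subst edges_5[OF V], subst V) (simp add: insert_commute)
  next
    case 3
    then show ?thesis
      using dnn_good_path5[of a c w v b] d distinct_rev[THEN iffD2, OF d] P1
      by (subst edges_5[OF V], subst V) (simp add: insert_commute)
  qed
qed

text \<open>The second index in the next three names is the degree of the vertex \<open>w\<close> outside the closed
  neighbourhood of \<open>v\<close>.\<close>

lemma dnn_good_5_degree_3_1:
  assumes V: "V = {v, a, b, c, w}" and d: "distinct [v, a, b, c, w]"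
    and P1: "P v a" "P v b" "P v c" "\<not> P v w" "P w a" "\<not> P w b" "\<not> P w c"
  shows "dnn_good V E"
proof -
  \<comment> \<open>\<open>a\<close> is adjacent to \<open>v\<close> and \<open>w\<close>; with
    \<open>b\<close> and \<open>c\<close> as well it would dominate.\<close>
  have "\<not> (P a b \<and> P a c)"
    using nodom[of a] V d P1 by (auto simp: P_sym)
  then consider "\<not> P a b" "\<not> P a c" "\<not> P b c" | "\<not> P a b" "\<not> P a c" "P b c"
    | "P a b" "\<not> P a c" "\<not> P b c" | "\<not> P a b" "P a c" "\<not> P b c"
    | "P a b" "\<not> P a c" "P b c" | "\<not> P a b" "P a c" "P b c"
    by blast
  then show ?thesis
  proof cases
    case 1
    then show ?thesis
      using dnn_good_fork[of v a w b c] d distinct_rev[THEN iffD2, OF d] P1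
      by (subst edges_5[OF V], subst V) (simp add: insert_commute P_sym[of _ w])
  next
    case 2
    then show ?thesis
      using dnn_good_tadpole[of v b c a w] d distinct_rev[THEN iffD2, OF d] P1
      by (subst edges_5[OF V], subst V) (simp add: insert_commute P_sym[of _ w])
  next
    case 3
    then show ?thesis
      using dnn_good_bull[of b v a w c] d distinct_rev[THEN iffD2, OF d] P1
      by (subst edges_5[OF V], subst V) (simp add: insert_commute P_sym[of _ w])
  next
    case 4
    then show ?thesis
      using dnn_good_bull[of c v a w b] d distinct_rev[THEN iffD2, OF d] P1
      by (subst edges_5[OF V], subst V) (simp add: insert_commute P_sym[of _ w])
  next
    case 5
    then show ?thesis
      using dnn_good_kite[of a c v b w] d distinct_rev[THEN iffD2, OF d] P1
      by (subst edges_5[OF V], subst V) (simp add: insert_commute P_sym[of _ w])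
  next
    case 6
    then show ?thesis
      using dnn_good_kite[of a b v c w] d distinct_rev[THEN iffD2, OF d] P1
      by (subst edges_5[OF V], subst V) (simp add: insert_commute P_sym[of _ w])
  qed
qed

lemma dnn_good_5_degree_3_2:
  assumes V: "V = {v, a, b, c, w}" and d: "distinct [v, a, b, c, w]"
    and P1: "P v a" "P v b" "P v c" "\<not> P v w" "P w a" "P w b" "\<not> P w c"
  shows "dnn_good V E"
proof -
  have "\<not> (P a b \<and> P a c)" "\<not> (P a b \<and> P b c)"
    using nodom[of a] nodom[of b] V d P1 by (auto simp: P_sym)
  then consider "\<not> P a b" "\<not> P a c" "\<not> P b c" | "P a b" "\<not> P a c" "\<not> P b c"
    | "\<not> P a b" "\<not> P a c" "P b c" | "\<not> P a b" "P a c" "\<not> P b c" | "\<not> P a b" "P a c" "P b c"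
    by blast
  then show ?thesis
  proof cases
    case 1
    then show ?thesis
      using dnn_good_banner[of v w a b c] d distinct_rev[THEN iffD2, OF d] P1
      by (subst edges_5[OF V], subst V) (simp add: insert_commute P_sym[of _ w])
  next
    case 2
    then show ?thesis
      using dnn_good_kite[of v w a b c] d distinct_rev[THEN iffD2, OF d] P1
      by (subst edges_5[OF V], subst V) (simp add: insert_commute P_sym[of _ w])
  next
    case 3
    then show ?thesis
      using dnn_good_house[of c b v w a] d distinct_rev[THEN iffD2, OF d] P1
      by (subst edges_5[OF V], subst V) (simp add: insert_commute P_sym[of _ w])
  next
    case 4
    then show ?thesis
      using dnn_good_house[of c a v w b] d distinct_rev[THEN iffD2, OF d] P1
      by (subst edges_5[OF V], subst V) (simp add: insert_commute P_sym[of _ w])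
  next
    case 5
    then show ?thesis
      using dnn_good_K23_plus_edge[of v c w a b] d distinct_rev[THEN iffD2, OF d] P1
      by (subst edges_5[OF V], subst V) (simp add: insert_commute P_sym[of _ w])
  qed
qed

text \<open>Two edges among \<open>a\<close>, \<open>b\<close>, \<open>c\<close> would share an
  endpoint, and this endpoint would dominate; so there is at most one.\<close>

lemma dnn_good_5_degree_3_3:
  assumes V: "V = {v, a, b, c, w}" and d: "distinct [v, a, b, c, w]"
    and P1: "P v a" "P v b" "P v c" "\<not> P v w" "P w a" "P w b" "P w c"
  shows "dnn_good V E"
proof -
  have "\<not> (P a b \<and> P a c)" "\<not> (P a b \<and> P b c)" "\<not> (P a c \<and> P b c)"
    using nodom[of a] nodom[of b] nodom[of c] V d P1 by (auto simp: P_sym)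
  then consider "\<not> P a b" "\<not> P a c" "\<not> P b c" | "P a b" "\<not> P a c" "\<not> P b c"
    | "\<not> P a b" "P a c" "\<not> P b c" | "\<not> P a b" "\<not> P a c" "P b c"
    by blast
  then show ?thesis
  proof cases
    case 1
    then show ?thesis
      using dnn_good_K23[of v w a b c] d distinct_rev[THEN iffD2, OF d] P1
      by (subst edges_5[OF V], subst V) (simp add: insert_commute P_sym[of _ w])
  next
    case 2
    then show ?thesis
      using dnn_good_K23_plus_edge[of a b c v w] d distinct_rev[THEN iffD2, OF d] P1
      by (subst edges_5[OF V], subst V) (simp add: insert_commute P_sym[of _ w])
  next
    case 3
    then show ?thesis
      using dnn_good_K23_plus_edge[of a c b v w] d distinct_rev[THEN iffD2, OF d] P1
      by (subst edges_5[OF V], subst V) (simp add: insert_commute P_sym[of _ w])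
  next
    case 4
    then show ?thesis
      using dnn_good_K23_plus_edge[of b c a v w] d distinct_rev[THEN iffD2, OF d] P1
      by (subst edges_5[OF V], subst V) (simp add: insert_commute P_sym[of _ w])
  qed
qed

lemma dnn_good_5_degree_3:
  assumes V: "V = {v, a, b, c, w}" and d: "distinct [v, a, b, c, w]"
    and P1: "P v a" "P v b" "P v c" "\<not> P v w"
  shows "dnn_good V E"
proof -
  have "P w a \<or> P w b \<or> P w c"
    using conn[of "{w}"] V d P1 by (auto simp: P_sym)
  then consider "P w a" "P w b" "P w c"
    | "P w a" "P w b" "\<not> P w c" | "P w a" "\<not> P w b" "P w c" | "\<not> P w a" "P w b" "P w c"
    | "P w a" "\<not> P w b" "\<not> P w c" | "\<not> P w a" "P w b" "\<not> P w c" | "\<not> P w a" "\<not> P w b" "P w c"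
    by blast
  then show ?thesis
  proof cases
    case 1 then show ?thesis using V d P1 by (intro dnn_good_5_degree_3_3[of v a b c w])
  next
    case 2 then show ?thesis using V d P1 by (intro dnn_good_5_degree_3_2[of v a b c w])
  next
    case 3 then show ?thesis using V d P1 by (intro dnn_good_5_degree_3_2[of v a c b w]) auto
  next
    case 4 then show ?thesis using V d P1 by (intro dnn_good_5_degree_3_2[of v b c a w]) auto
  next
    case 5 then show ?thesis using V d P1 by (intro dnn_good_5_degree_3_1[of v a b c w])
  next
    case 6 then show ?thesis using V d P1 by (intro dnn_good_5_degree_3_1[of v b a c w]) auto
  next
    case 7 then show ?thesis using V d P1 by (intro dnn_good_5_degree_3_1[of v c a b w]) auto
  qed
qed

lemma dnn_good_connected_no_dominating:
  assumes "card V \<le> 5" "V \<noteq> {}"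
  shows "dnn_good V E"
proof -
  have P_in: "x \<in> V" "y \<in> V" "x \<noteq> y" if "P x y" for x y
    using that finite_simple_graph_edgeE[OF G, of "{x, y}"] unfolding P
    by (auto simp: doubleton_eq_iff)
  obtain x where x: "x \<in> V" using assms by blast
  obtain y where y: "P x y"
    using conn[of "{x}"] nodom[OF x] x by auto
  have "V \<noteq> {x, y}"
    using nodom[OF x] y by auto
  \<comment> \<open>An edge leaving \<open>{x, y}\<close> shares an endpoint with the edge between
    \<open>x\<close> and \<open>y\<close>; this endpoint is the vertex \<open>v\<close> of degree at
    least two.\<close>
  then obtain p q where "p \<in> {x, y}" "q \<in> V - {x, y}" "P p q"
    using conn[of "{x, y}"] P_in[OF y] by blast
  then obtain v a b where v: "P v a" "P v b" "a \<noteq> b"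
    using y P_sym[of x y] by blast
  obtain w where w: "w \<in> V" "w \<noteq> v" "\<not> P v w"
    using nodom[of v] P_in v by blast
  have sub: "{v, a, b, w} \<subseteq> V" and d: "distinct [v, a, b, w]"
    using P_in v w by auto
  have fin: "finite V" using G by (simp add: finite_simple_graph_def)
  show ?thesis
  proof (cases "V = {v, a, b, w}")
    case True
    then show ?thesis using d v w by (intro dnn_good_4)
  next
    case False
    then obtain c where c: "c \<in> V" "c \<notin> {v, a, b, w}"
      using sub by blast
    have "{v, a, b, c, w} \<subseteq> V" "card {v, a, b, c, w} = 5"
      using sub c d by auto
    then have V: "V = {v, a, b, c, w}"
      using assms(1) fin by (metis card_seteq)
    have d: "distinct [v, a, b, c, w]" using d c by auto
    show ?thesis
    proof (cases "\<exists>z p q r. distinct [p, q, r] \<and> P z p \<and> P z q \<and> P z r")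
      case True
      then obtain z p q r where z: "distinct [p, q, r]" "P z p" "P z q" "P z r" by blast
      then obtain s where s: "s \<in> V" "s \<noteq> z" "\<not> P z s"
        using nodom[of z] P_in by blast
      have "z \<noteq> p" "z \<noteq> q" "z \<noteq> r" "p \<noteq> s" "q \<noteq> s" "r \<noteq> s"
        using z s P_in(3) by blast+
      then have d': "distinct [z, p, q, r, s]"
        using z(1) s(2) by simp
      have "{z, p, q, r, s} \<subseteq> V" "card {z, p, q, r, s} = 5"
        using z s P_in(1,2) distinct_card[OF d'] by auto
      then have "V = {z, p, q, r, s}"
        using assms(1) fin by (metis card_seteq)
      then show ?thesis
        using d' z s by (intro dnn_good_5_degree_3)
    next
      case False
      then have deg: "\<And>z p q r. distinct [p, q, r] \<Longrightarrow> P z p \<Longrightarrow> P z q \<Longrightarrow> \<not> P z r"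
        by blast
      have vc: "\<not> P v c" using deg[of a b c v] v c d by auto
      \<comment> \<open>With maximum degree two, a triangle on \<open>v\<close>, \<open>a\<close>,
        \<open>b\<close> would be a component of its own.\<close>
      have ab: "\<not> P a b"
      proof
        assume "P a b"
        then have "\<not> P a u" "\<not> P b u" if "u \<notin> {v, a, b}" for u
          using deg[of v b u a] deg[of v a u b] v that P_sym P_in by auto
        then show False
          using conn[of "{v, a, b}"] V d vc w by auto
      qed
      consider "P a c" | "P a w" | "P b c" | "P b w"
        using conn[of "{v, a, b}"] V d vc w by auto
      then show ?thesis
      proof cases
        case 1
        then show ?thesis using V d v w vc ab deg by (intro dnn_good_5_degree_2[of v a b c w])
      next
        case 2
        then show ?thesis using V d v w vc ab deg by (intro dnn_good_5_degree_2[of v a b w c]) auto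
      next
        case 3
        then show ?thesis using V d v w vc ab deg P_sym[of a b]
          by (intro dnn_good_5_degree_2[of v b a c w]) auto
      next
        case 4
        then show ?thesis using V d v w vc ab deg P_sym[of a b]
          by (intro dnn_good_5_degree_2[of v b a w c]) auto
      qed
    qed
  qed
qed

end

lemma dnn_good_card_le_5:
  assumes "finite_simple_graph V E" "card V \<le> 5"
  shows "dnn_good V E"
  using assms
proof (induction "card V" arbitrary: V E rule: less_induct)
  case less
  note G = less.prems(1)
  have fin: "finite V" using G by (simp add: finite_simple_graph_def)
  have sub: "dnn_good S {e \<in> E. e \<subseteq> S}" if "S \<subset> V" for S
    using that G fin less.prems(2) psubset_card_mono[OF fin that]
    by (intro less.hyps) (auto simp: finite_simple_graph_def intro: finite_subset)
  consider (empty) "V = {}"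
    | (dominating) z where "z \<in> V" "\<And>u. u \<in> V \<Longrightarrow> u \<noteq> z \<Longrightarrow> {z, u} \<in> E"
    | (disconnected) S where "S \<subset> V" "S \<noteq> {}" "\<And>x y. x \<in> S \<Longrightarrow> y \<in> V - S \<Longrightarrow> {x, y} \<notin> E"
    | (other) "V \<noteq> {}" "\<And>z. z \<in> V \<Longrightarrow> \<exists>u\<in>V. u \<noteq> z \<and> {z, u} \<notin> E"
      "\<And>S. S \<subseteq> V \<Longrightarrow> S \<noteq> {} \<Longrightarrow> S \<noteq> V \<Longrightarrow> \<exists>x\<in>S. \<exists>y\<in>V - S. {x, y} \<in> E"
    by (metis psubsetI)
  then show ?case
  proof cases
    case empty
    then have "E = {}" using G by (auto simp: finite_simple_graph_def)
    then show ?thesis by (simp add: dnn_good_empty)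
  next
    case (dominating z)
    have "{e \<in> E. z \<notin> e} = {e \<in> E. e \<subseteq> V - {z}}"
      using G by (auto simp: finite_simple_graph_def)
    moreover have "V - {z} \<subset> V"
      using dominating(1) by blast
    ultimately show ?thesis
      using sub[of "V - {z}"] by (intro dnn_good_dominating[OF G dominating]) simp_all
  next
    case (disconnected S)
    then show ?thesis
      using sub[of S] sub[of "V - S"] by (intro dnn_good_disconnected[OF G, of S]) auto
  next
    case other
    then show ?thesis
      using dnn_good_connected_no_dominating[OF G refl] less.prems(2) by blast
  qed
qed

section \<open>Passage to product-measurable kernels\<close>

lemma (in complete_measure) borel_measurable_AE_eq:
  fixes f f0 :: "'a \<Rightarrow> real"
  assumes [measurable]: "f0 \<in> borel_measurable M" and ae: "AE x in M. f x = f0 x"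
  shows "f \<in> borel_measurable M"
proof (rule measurableI)
  fix A :: "real set" assume [measurable]: "A \<in> sets borel"
  have "AE x in M. x \<in> f0 -` A \<inter> space M \<longleftrightarrow> x \<in> f -` A \<inter> space M"
    using ae by eventually_elim auto
  moreover have "f0 -` A \<inter> space M \<in> sets M" by measurable
  ultimately show "f -` A \<inter> space M \<in> sets M"
    by (rule in_sets_AE) simp
qed simp

lemma (in complete_measure) integral_AE_eq:
  fixes f f0 :: "'a \<Rightarrow> real"
  assumes "f0 \<in> borel_measurable M" "AE x in M. f x = f0 x"
  shows "(\<integral>x. f x \<partial>M) = (\<integral>x. f0 x \<partial>M)"
  using assms by (intro integral_cong_AE borel_measurable_AE_eq[OF assms])

lemma complete_measure_unit_measure: "complete_measure unit_measure"
proof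
  fix A B :: "real set"
  assume "B \<subseteq> A" "A \<in> null_sets unit_measure"
  then have "A \<in> null_sets lebesgue" "A \<subseteq> {0..1}"
    by (auto simp: null_sets_restrict_space)
  then have "B \<in> null_sets lebesgue" "B \<subseteq> {0..1}"
    using \<open>B \<subseteq> A\<close> by (auto intro: null_sets_completion_subset)
  then show "B \<in> sets unit_measure"
    by (auto simp: sets_restrict_space_iff)
qed

lemma prob_space_unit_measure: "prob_space unit_measure"
  by (intro prob_spaceI) (simp add: emeasure_restrict_space)

text \<open>Clipping bounds a representative at every point and leaves it unchanged wherever it
  agrees with the bounded original.\<close>

definition clip :: "real \<Rightarrow> real \<Rightarrow> real \<Rightarrow> real" where
  "clip a b r = max a (min b r)"

lemma clip_measurable [measurable]: "clip a b \<in> borel_measurable borel"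
  unfolding clip_def[abs_def] by measurable

lemma clip_bounds: "a \<le> b \<Longrightarrow> a \<le> clip a b r \<and> clip a b r \<le> b"
  by (simp add: clip_def)

lemma clip_id: "a \<le> r \<Longrightarrow> r \<le> b \<Longrightarrow> clip a b r = r"
  by (simp add: clip_def)

lemma bounded_measurable_representative:
  assumes "h \<in> bounded_measurable"
  obtains h0 where "(\<lambda>(x, y). h0 x y) \<in> borel_measurable (unit_measure \<Otimes>\<^sub>M unit_measure)"
    "bounded_fun (\<lambda>(x, y). h0 x y)" "AE (x, y) in unit_measure \<Otimes>\<^sub>M unit_measure. h (x, y) = h0 x y"
proof -
  obtain B where "\<forall>r \<in> h ` ({0..1} \<times> {0..1}). norm r \<le> B"
    using assms unfolding bounded_measurable_def bounded_iff by blast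
  then have B: "\<bar>h (x, y)\<bar> \<le> B" if "x \<in> {0..1}" "y \<in> {0..1}" for x y
    using that by auto
  have "0 \<le> B"
    using order_trans[OF abs_ge_zero B[of 0 0]] by simp
  obtain h1 where h1 [measurable]: "h1 \<in> borel_measurable (unit_measure \<Otimes>\<^sub>M unit_measure)"
    and eq: "AE p in unit_measure \<Otimes>\<^sub>M unit_measure. h p = h1 p"
    using assms completion_ex_borel_measurable_real[of h] unfolding bounded_measurable_def by blast
  have *: "\<bar>clip (- B) B r\<bar> \<le> B" for r
    using clip_bounds[of "- B" B r] \<open>0 \<le> B\<close> by auto
  show ?thesis
  proof (rule that[of "\<lambda>x y. clip (- B) B (h1 (x, y))"])
    show "bounded_fun (\<lambda>(x, y). clip (- B) B (h1 (x, y)))"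
      using * by (intro bounded_funI[of _ B]) (auto simp: case_prod_beta')
    show "AE (x, y) in unit_measure \<Otimes>\<^sub>M unit_measure. h (x, y) = clip (- B) B (h1 (x, y))"
      using eq AE_space
    proof eventually_elim
      case (elim p)
      then have "\<bar>h p\<bar> \<le> B"
        using B[of "fst p" "snd p"] by (auto simp: space_pair_measure)
      then show ?case
        using elim(1) by (auto simp: case_prod_beta' clip_id)
    qed
  qed measurable
qed

text \<open>Averaging over the swap of coordinates and cutting off at 0 makes symmetry and
  nonnegativity hold everywhere. The Schur property comes from the factorisation: the form of
  \<open>R x y * k x y\<close> at \<open>\<phi>\<close> is the average over \<open>z\<close> of the
  form of \<open>R\<close> at \<open>\<phi> x * h0 x z\<close>.\<close>

lemma doubly_nonnegative_representative:
  assumes g: "doubly_nonnegative g"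
  obtains g0 where "dnn_kernel unit_measure g0"
    "AE (x, y) in unit_measure \<Otimes>\<^sub>M unit_measure. g (x, y) = g0 x y"
proof -
  interpret U: prob_space unit_measure by (rule prob_space_unit_measure)
  interpret C: complete_measure unit_measure by (rule complete_measure_unit_measure)
  interpret PU: pair_prob_space unit_measure unit_measure ..
  let ?U = "unit_measure" and ?U2 = "unit_measure \<Otimes>\<^sub>M unit_measure"
  obtain g1 where g1 [measurable]: "(\<lambda>(x, y). g1 x y) \<in> borel_measurable ?U2"
    and bd1: "bounded_fun (\<lambda>(x, y). g1 x y)"
    and g1_eq: "AE (x, y) in ?U2. g (x, y) = g1 x y"
    using g bounded_measurable_representative[of g] unfolding doubly_nonnegative_def by blast
  obtain h where h: "h \<in> bounded_measurable"
    and gh: "AE (x, y) in ?U2. g (x, y) = (\<integral>z. h (x, z) * h (y, z) \<partial>?U)"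
    using g unfolding doubly_nonnegative_def AE_completion_iff by blast
  obtain h0 where h0 [measurable]: "(\<lambda>(x, y). h0 x y) \<in> borel_measurable ?U2"
    and bdh: "bounded_fun (\<lambda>(x, y). h0 x y)"
    and h0_eq: "AE (x, y) in ?U2. h (x, y) = h0 x y"
    using bounded_measurable_representative[OF h] by blast
  define g0 where "g0 x y = max 0 ((g1 x y + g1 y x) / 2)" for x y
  have g0m [measurable]: "(\<lambda>(x, y). g0 x y) \<in> borel_measurable ?U2"
    unfolding g0_def[abs_def] by measurable
  have bdh': "bounded_fun (\<lambda>p. h0 (a p) (b p))" for a b :: "'c \<Rightarrow> real"
    using bounded_fun_comp[OF bdh, of "\<lambda>p. (a p, b p)"] by simp
  have bd1': "bounded_fun (\<lambda>p. g1 (a p) (b p))" for a b :: "'c \<Rightarrow> real"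
    using bounded_fun_comp[OF bd1, of "\<lambda>p. (a p, b p)"] by simp
  have bdg: "bounded_fun (\<lambda>p. g0 (a p) (b p))" for a b :: "'c \<Rightarrow> real"
  proof (rule bounded_fun_le)
    show "bounded_fun (\<lambda>p. 1 + ((g1 (a p) (b p) + g1 (b p) (a p)) * (1 / 2))\<^sup>2)"
      by (intro bounded_fun_intros bd1')
    \<comment> \<open>A polynomial bound, so that the closure rules for boundedness apply to
      it.\<close>
    show "\<bar>g0 (a p) (b p)\<bar> \<le> 1 + ((g1 (a p) (b p) + g1 (b p) (a p)) * (1 / 2))\<^sup>2" for p
    proof -
      have "\<bar>max 0 t\<bar> \<le> 1 + t\<^sup>2" for t :: real
        using zero_le_power2[of "t - 1 / 2"] by (auto simp: power2_eq_square algebra_simps max_def)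
      then show ?thesis by (simp add: g0_def)
    qed
  qed
  have "AE p in distr ?U2 ?U2 (\<lambda>(x, y). (y, x)). g p = g1 (fst p) (snd p)"
    using g1_eq by (subst PU.distr_pair_swap[symmetric]) (simp add: case_prod_beta')
  then have "AE p in ?U2. g (snd p, fst p) = g1 (snd p) (fst p)"
    by (auto dest!: AE_distrD[rotated] simp: case_prod_beta')
  with g1_eq AE_space have g0_eq: "AE (x, y) in ?U2. g (x, y) = g0 x y"
  proof eventually_elim
    case (elim p)
    then have p: "fst p \<in> {0..1}" "snd p \<in> {0..1}"
      by (auto simp: space_pair_measure)
    then have "g (snd p, fst p) = g p" "0 \<le> g p"
      using g unfolding doubly_nonnegative_def by (metis prod.collapse)+
    then show ?case
      using elim by (simp add: case_prod_beta' g0_def)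
  qed
  define k where "k x y = (\<integral>z. h0 x z * h0 y z \<partial>?U)" for x y
  have km [measurable]: "(\<lambda>(x, y). k x y) \<in> borel_measurable ?U2"
    unfolding k_def[abs_def] by measurable
  have bdk: "bounded_fun (\<lambda>p. k (a p) (b p))" for a b :: "'c \<Rightarrow> real"
    unfolding k_def by (intro U.bounded_fun_integral bounded_fun_intros bdh')
  have row: "AE x in ?U. AE z in ?U. h (x, z) = h0 x z"
    using PU.AE_pair[OF h0_eq] by simp
  have gk: "AE x in ?U. AE y in ?U. g0 x y = k x y"
  proof -
    have "AE x in ?U. AE y in ?U. g (x, y) = g0 x y"
      "AE x in ?U. AE y in ?U. g (x, y) = (\<integral>z. h (x, z) * h (y, z) \<partial>?U)"
      using PU.AE_pair[OF g0_eq] PU.AE_pair[OF gh] by simp_all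
    with row AE_space show ?thesis
    proof eventually_elim
      case (elim x)
      note x = elim
      from x(3,4) row AE_space show ?case
      proof eventually_elim
        case (elim y)
        have [measurable]: "x \<in> space ?U" "y \<in> space ?U" using x(2) elim(4) by auto
        have "AE z in ?U. h (x, z) * h (y, z) = h0 x z * h0 y z"
          using x(1) elim(3) by eventually_elim simp
        \<comment> \<open>Sections of \<open>h\<close> are known only to agree almost everywhere
          with measurable ones; completeness of Lebesgue measure makes them measurable, so the
          integrals agree.\<close>
        then have "(\<integral>z. h (x, z) * h (y, z) \<partial>?U) = k x y"
          unfolding k_def by (intro C.integral_AE_eq) measurable
        then show ?case using elim by simp
      qed
    qed
  qed
  have "dnn_kernel ?U g0"
  proof
    show "0 \<le> g0 x y" "g0 x y = g0 y x" for x y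
      by (auto simp: g0_def add.commute)
    show "bounded_fun (\<lambda>(x, y). g0 x y)"
      using bdg[of fst snd] by (simp add: case_prod_beta')
    fix R
    assume [measurable]: "(\<lambda>(x, y). R x y) \<in> borel_measurable ?U2"
      and bdR: "bounded_fun (\<lambda>(x, y). R x y)" and psd: "psd_kernel ?U R"
    have bdR': "bounded_fun (\<lambda>p. R (a p) (b p))" for a b :: "'c \<Rightarrow> real"
      using bounded_fun_comp[OF bdR, of "\<lambda>p. (a p, b p)"] by simp
    show "psd_kernel ?U (\<lambda>x y. R x y * g0 x y)"
      unfolding psd_kernel_def
    proof (intro allI impI)
      fix \<phi> :: "real \<Rightarrow> real"
      assume [measurable]: "\<phi> \<in> borel_measurable ?U" and bd: "bounded_fun \<phi>"
      note bd' = bd[THEN bounded_fun_comp]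
      let ?F = "\<lambda>x y z. (\<phi> x * h0 x z) * R x y * (\<phi> y * h0 y z)"
      have "0 \<le> (\<integral>z. \<integral>x. \<integral>y. ?F x y z \<partial>?U \<partial>?U \<partial>?U)"
      proof (rule integral_nonneg_AE[OF AE_I2])
        fix z assume [measurable]: "z \<in> space ?U"
        show "0 \<le> (\<integral>x. \<integral>y. ?F x y z \<partial>?U \<partial>?U)"
          by (rule psd[unfolded psd_kernel_def, rule_format])
            (measurable, intro bounded_fun_intros bd bdh')
      qed
      also have "\<dots> = (\<integral>x. \<integral>z. \<integral>y. ?F x y z \<partial>?U \<partial>?U \<partial>?U)"
        by (intro U.integral_swap)
          (auto simp: case_prod_beta' intro!: U.bounded_fun_integral bounded_fun_intros bd' bdR' bdh')
      also have "\<dots> = (\<integral>x. \<integral>y. \<integral>z. ?F x y z \<partial>?U \<partial>?U \<partial>?U)"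
        by (intro Bochner_Integration.integral_cong refl U.integral_swap)
          (auto simp: case_prod_beta' intro!: bounded_fun_intros bd' bdR' bdh')
      also have "\<dots> = (\<integral>x. \<integral>y. \<phi> x * (R x y * k x y) * \<phi> y \<partial>?U \<partial>?U)"
        unfolding k_def by (simp add: ac_simps flip: integral_mult_right_zero)
      also have "\<dots> = (\<integral>x. \<integral>y. \<phi> x * (R x y * g0 x y) * \<phi> y \<partial>?U \<partial>?U)"
      proof (rule integral_cong_AE)
        show "AE x in ?U. (\<integral>y. \<phi> x * (R x y * k x y) * \<phi> y \<partial>?U) = (\<integral>y. \<phi> x * (R x y * g0 x y) * \<phi> y \<partial>?U)"
          using gk AE_space
        proof eventually_elim
          case (elim x)
          then have [measurable]: "x \<in> space ?U" by simp
          show ?case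
          proof (rule integral_cong_AE)
            show "AE y in ?U. \<phi> x * (R x y * k x y) * \<phi> y = \<phi> x * (R x y * g0 x y) * \<phi> y"
              using elim(1) by eventually_elim simp
          qed measurable
        qed
      qed measurable
      finally show "0 \<le> (\<integral>x. \<integral>y. \<phi> x * (R x y * g0 x y) * \<phi> y \<partial>?U \<partial>?U)" .
    qed
  qed (fact g0m)
  then show ?thesis using g0_eq that by blast
qed

text \<open>Two distinct coordinates are jointly distributed as the product of \<open>M\<close> with
  itself. This is checked on the indicator of a null set covering the exceptions, by integrating out
  the other coordinates.\<close>

lemma (in prob_space) AE_PiM_pair:
  fixes V :: "'v set"
  assumes V: "finite V" "u \<in> V" "v \<in> V" "u \<noteq> v" and ae: "AE p in M \<Otimes>\<^sub>M M. Q p"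
  shows "AE x in Pi\<^sub>M V (\<lambda>_. M). Q (x u, x v)"
proof -
  interpret P: pair_prob_space M M ..
  interpret V: prob_space "Pi\<^sub>M V (\<lambda>_. M)" by (rule prob_space_PiM')
  define W where "W = V - {u, v}"
  interpret W: prob_space "Pi\<^sub>M W (\<lambda>_. M)" by (rule prob_space_PiM')
  have VW: "V = insert u (insert v W)" "u \<notin> insert v W" "v \<notin> W" "finite W"
    using V by (auto simp: W_def)
  obtain N where N: "{p \<in> space (M \<Otimes>\<^sub>M M). \<not> Q p} \<subseteq> N" "emeasure (M \<Otimes>\<^sub>M M) N = 0"
    and [measurable]: "N \<in> sets (M \<Otimes>\<^sub>M M)"
    using ae by (elim AE_E)
  let ?i = "\<lambda>p. indicator N p :: real"
  have [measurable]: "(\<lambda>x. x w) \<in> Pi\<^sub>M V (\<lambda>_. M) \<rightarrow>\<^sub>M M" if "w \<in> V" for w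
    using that by (rule measurable_component_singleton)
  have m: "(\<lambda>x. ?i (x u, x v)) \<in> borel_measurable (Pi\<^sub>M V (\<lambda>_. M))"
    using V by measurable
  have bd: "bounded_fun (\<lambda>x. ?i (k x))" for k :: "'c \<Rightarrow> _"
    by (intro bounded_funI[of _ 1]) (simp add: indicator_def)
  have "(\<integral>x. ?i (x u, x v) \<partial>Pi\<^sub>M V (\<lambda>_. M)) = (\<integral>y. \<integral>y'. ?i (y, y') \<partial>M \<partial>M)"
    unfolding VW(1)
  proof (rule integral_PiM_insert_cong)
    fix y
    assume "(\<lambda>x. ?i ((x(u := y)) u, (x(u := y)) v)) \<in> borel_measurable (Pi\<^sub>M (insert v W) (\<lambda>_. M))"
    then show "(\<integral>x. ?i ((x(u := y)) u, (x(u := y)) v) \<partial>Pi\<^sub>M (insert v W) (\<lambda>_. M)) = (\<integral>y'. ?i (y, y') \<partial>M)"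
      using VW V(4) bd by (intro integral_PiM_insert_cong) (auto simp: W.prob_space)
  qed (use VW m bd in auto)
  also have "\<dots> = (\<integral>p. ?i p \<partial>(M \<Otimes>\<^sub>M M))"
    using P.integral_fst'[of ?i] bd[of "\<lambda>x. x"] by (simp add: P.P.integrable_bounded_fun)
  also have "\<dots> = 0"
    using N by (simp add: measure_def)
  finally have "AE x in Pi\<^sub>M V (\<lambda>_. M). ?i (x u, x v) = 0"
    by (subst (asm) integral_nonneg_eq_0_iff_AE) (auto intro!: V.integrable_bounded_fun m bd)
  with AE_space show ?thesis
  proof eventually_elim
    case (elim x)
    then have "x u \<in> space M" "x v \<in> space M"
      using V by (auto simp: space_PiM)
    then show ?case
      using elim(2) N(1) by (auto simp: indicator_def space_pair_measure split: if_splits)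
  qed
qed

theorem theorem7p1:
  fixes V :: "'v set" and E :: "'v set set"
  assumes "finite_simple_graph V E"
    and "card V \<le> 5"
  shows "good_graph V E"
  unfolding good_graph_def
proof (intro allI impI)
  fix g assume g: "doubly_nonnegative g"
  have sym: "\<forall>x\<in>{0..1}. \<forall>y\<in>{0..1}. g (x, y) = g (y, x)"
    using g unfolding doubly_nonnegative_def by blast
  obtain g0 where K: "dnn_kernel unit_measure g0"
    and g0: "AE (x, y) in unit_measure \<Otimes>\<^sub>M unit_measure. g (x, y) = g0 x y"
    using doubly_nonnegative_representative[OF g] .
  interpret dnn_kernel unit_measure g0 by fact
  interpret P: pair_prob_space unit_measure unit_measure ..
  let ?P = "Pi\<^sub>M V (\<lambda>_. unit_measure)"
  have fin: "finite V" "finite E"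
    using assms(1) finite_simple_graph_finite_edges by (auto simp: finite_simple_graph_def)
  have "(\<integral>p. g p \<partial>unit_square_measure) = (\<integral>p. g0 (fst p) (snd p) \<partial>unit_square_measure)"
    using g0 by (intro completion.integral_AE_eq measurable_completion AE_completion)
      (auto simp: case_prod_beta')
  also have "\<dots> = (\<integral>p. g0 (fst p) (snd p) \<partial>(unit_measure \<Otimes>\<^sub>M unit_measure))"
    by (intro integral_completion) measurable
  also have "\<dots> = edge_density"
    unfolding edge_density_def deg_def
    by (subst P.integral_fst'[symmetric]) (auto intro!: P.P.integrable_bounded_fun bounded_fun_intros)
  finally have p: "(\<integral>p. g p \<partial>unit_square_measure) = edge_density" .
  \<comment> \<open>A null set of the square pulls back to a null set of the cube along the two
    endpoints of an edge; finitely many edges keep the exceptional set null.\<close>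
  have "AE x in ?P. edge_factor g x e = edge_factor (case_prod g0) x e" if "e \<in> E" for e
  proof -
    obtain u v where e: "e = {u, v}" "u \<noteq> v" "u \<in> V" "v \<in> V"
      using assms(1) \<open>e \<in> E\<close> by (elim finite_simple_graph_edgeE)
    have "AE x in ?P. (\<lambda>(a, b). g (a, b) = g0 a b) (x u, x v)"
      using g0 e fin by (intro AE_PiM_pair) auto
    with AE_space show ?thesis
    proof eventually_elim
      case (elim x)
      then have "x u \<in> {0..1}" "x v \<in> {0..1}"
        using e by (auto simp: space_PiM PiE_iff)
      then show ?case
        using elim(2) e sym by (simp add: edge_factor_eq edge_factor_doubleton g_sym)
    qed
  qed
  then have "AE x in ?P. \<forall>e\<in>E. edge_factor g x e = edge_factor (case_prod g0) x e"
    using fin by (simp add: AE_finite_all)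
  then have "AE x in ?P. (\<Prod>e\<in>E. edge_factor g x e) = edge_prod g0 E x"
    by eventually_elim (simp add: edge_prod_def)
  then have "hom_density V E g = (\<integral>x. edge_prod g0 E x \<partial>completion ?P)"
    unfolding hom_density_def
    by (intro completion.integral_AE_eq measurable_completion AE_completion
      edge_prod_measurable[OF K assms(1)]) simp_all
  also have "\<dots> = graph_density unit_measure V E g0"
    unfolding graph_density_def
    by (intro integral_completion edge_prod_measurable[OF K assms(1)]) simp
  finally show "(LINT p|unit_square_measure. g p) ^ card E \<le> hom_density V E g"
    using dnn_good_card_le_5[OF assms] K p unfolding dnn_good_def by simp
qed

end
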